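(* Let $A\in\mathbb{R}^{m\times n}$ have simple singular values $\sigma_1>\cdots>\sigma_n>0$ and let $b\in\mathbb{R}^m$. Assume that the problem $\min_x\|Ax-b\|$ is severely ill-posed with $\sigma_i=\zeta\rho^{-i}$ and $\rho>1$, or moderately ill-posed with $\sigma_i=\zeta i^{-\alpha}$ and $\alpha>1$ ($i=1,\dots,n$, $\zeta>0$ a constant), and that the discrete Picard condition with parameter $\beta>0$ is satisfied (in the sense of the context). Let the Ritz values, i.e. the singular values of the matrix $B_k$ generated by $k$-step Lanczos bidiagonalization, be labeled as $\theta_1^{(k)}>\theta_2^{(k)}>\cdots>\theta_k^{(k)}$, and let $\eta_k$ be as defined in the context. Then for $k=1,2,\dots,k_0$, $$0<\sigma_i-\theta_i^{(k)}\le\sqrt{1+\eta_k^2}\,\sigma_{k+1},\quad i=1,2,\dots,k.$$ If $\rho\ge1+\sqrt2$ (in the severely ill-posed case), or if $\alpha>1$ (in the moderately ill-posed case) satisfies $$1+\sqrt{1+\eta_k^2}<\left(\frac{k_0+1}{k_0}\right)^{\alpha},\quad k=1,2,\dots,k_0,$$ then the $k$ Ritz values $\theta_i^{(k)}$ strictly interlace the first $k+1$ large singular values of $A$ and approximate the first $k$ large ones in natural order for $k=1,2,\dots,k_0$: $$\sigma_{i+1}<\theta_i^{(k)}<\sigma_i,\quad i=1,2,\dots,k,$$ meaning that there is no Ritz value $\theta_i^{(k)}$ smaller than $\sigma_{k_0+1}$ for $k=1,2,\dots,k_0$.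
   Context: $\|\cdot\|$ is the 2-norm. The SVD of $A$ is $A=U\begin{pmatrix}\Sigma\\ \mathbf{0}\end{pmatrix}V^T$ with $U=(u_1,\dots,u_m)$, $V=(v_1,\dots,v_n)$ orthogonal, $\Sigma=\mathrm{diag}(\sigma_1,\dots,\sigma_n)$; $\Sigma_k=\mathrm{diag}(\sigma_1,\dots,\sigma_k)$. Lanczos bidiagonalization: $p_1=b/\|b\|$, $\beta_1q_0=0$; for $j=1,\dots,k$: $r=A^Tp_j-\beta_jq_{j-1}$, $\alpha_j=\|r\|$, $q_j=r/\alpha_j$, $z=Aq_j-\alpha_jp_j$, $\beta_{j+1}=\|z\|$, $p_{j+1}=z/\beta_{j+1}$. $P_{k+1}=(p_1,\dots,p_{k+1})$, $Q_k=(q_1,\dots,q_k)$ have orthonormal columns, and $B_k=P_{k+1}^TAQ_k\in\mathbb{R}^{(k+1)\times k}$ is lower bidiagonal with diagonal $\alpha_1,\dots,\alpha_k$ and subdiagonal $\beta_2,\dots,\beta_{k+1}$. It is assumed that $b$ has nonzero components in all of $u_1,\dots,u_n$ and that Lanczos bidiagonalization can be run to completion, producing $P_{n+1},Q_n,B_n$ with all $\alpha_i,\beta_{i+1}>0$, $i=1,\dots,n$ (so $m>n$). (The Lanczos entries $\alpha_i,\beta_i$ are unrelated to the decay exponent $\alpha$ and the Picard parameter $\beta$.) Definition of $\Delta_k\in\mathbb{R}^{(n-k)\times k}$: let $D=\mathrm{diag}(\sigma_iu_i^Tb)\in\mathbb{R}^{n\times n}$ and let $T_k\in\mathbb{R}^{n\times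 k}$ have $i$-th row $(1,\sigma_i^2,\dots,\sigma_i^{2k-2})$. Partition $D=\mathrm{diag}(D_1,D_2)$ with $D_1\in\mathbb{R}^{k\times k}$ and $T_k=\begin{pmatrix}T_{k1}\\ T_{k2}\end{pmatrix}$ with $T_{k1}\in\mathbb{R}^{k\times k}$ (nonsingular). Then $\Delta_k=D_2T_{k2}T_{k1}^{-1}D_1^{-1}$. Definition of $\eta_k\ge0$: $\eta_k^2\sigma_{k+1}^2=\|\Sigma_k(I+\Delta_k^T\Delta_k)^{-1}\Delta_k^T\Delta_k\|^2+\|\Sigma_k(I+\Delta_k^T\Delta_k)^{-1}\Delta_k^T\|^2$. Discrete Picard condition and noise model: $b=\hat b+e$ with $|u_i^T\hat b|=\sigma_i^{1+\beta}$, $i=1,\dots,n$, $\beta>0$, and $e$ white noise of level $\eta>0$ (unrelated to $\eta_k$), i.e. $|u_i^Te|\approx\eta$. The transition index $k_0$ is the index at which $|u_{k_0}^T b|\approx|u_{k_0}^T\hat b|>|u_{k_0}^Te|\approx\eta$ and $|u_{k_0+1}^Tb|\approx|u_{k_0+1}^Te|\approx\eta$. These relations are used in the following exact idealized form: $|u_j^Tb|=\sigma_j^{1+\beta}$ for $j\le k_0$; $|u_j^Tb|=\eta$ for $k_0<j\le n$; $|u_{j+1}^Tb|\le|u_j^Tb|$ for $1\le j\le n-1$; and $|u_{k+1}^Tb|/|u_k^Tb|=(\sigma_{k+1}/\sigma_k)^{1+\beta}$ for $k\le k_0$, $|u_{k+1}^Tb|/|u_k^Tb|=1$ for $k>k_0$.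 *)

theory Defs
  imports Complex_Main "Jordan_Normal_Form.Gauss_Jordan_Elimination"
begin

text \<open>
  Vectors and matrices are the dimension-carrying ones of \<open>Jordan_Normal_Form\<close>, whose entries are
  numbered from 0.  All sequences of scalars and vectors (singular values, Ritz values, Lanczos
  vectors and coefficients) are functions on \<^typ>\<open>nat\<close> numbered from 1.
\<close>

definition vec_norm2 :: "real vec \<Rightarrow> real" where
  "vec_norm2 x = sqrt (scalar_prod x x)"

definition mat_norm2 :: "real mat \<Rightarrow> real" where
  "mat_norm2 M = (SUP x\<in>{x \<in> carrier_vec (dim_col M). vec_norm2 x \<le> 1}. vec_norm2 (M *\<^sub>v x))"

text \<open>\<open>orthogonal_mat\<close> of the library only asks for \<open>Q\<^sup>T Q\<close> to be diagonal and nonsingular.\<close>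

definition orthonormal_mat :: "nat \<Rightarrow> real mat \<Rightarrow> bool" where
  "orthonormal_mat n Q \<longleftrightarrow> Q \<in> carrier_mat n n \<and> transpose_mat Q * Q = 1\<^sub>m n"

text \<open>Only for matrices with at least as many rows as columns; \<open>s\<close> need not be ordered.\<close>

definition svd :: "real mat \<Rightarrow> real mat \<Rightarrow> (nat \<Rightarrow> real) \<Rightarrow> real mat \<Rightarrow> bool" where
  "svd M U s V \<longleftrightarrow>
     dim_col M \<le> dim_row M \<and>
     orthonormal_mat (dim_row M) U \<and> orthonormal_mat (dim_col M) V \<and>
     (\<forall>i\<in>{1..dim_col M}. 0 \<le> s i) \<and>
     M = U * mat (dim_row M) (dim_col M) (\<lambda>(i, j). if i = j then s (Suc i) else 0) * transpose_mat V"

definition singular_values :: "real mat \<Rightarrow> (nat \<Rightarrow> real) \<Rightarrow> bool" where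
  "singular_values M s \<longleftrightarrow> (\<exists>U V. svd M U s V)"

text \<open>\<open>coeff_col U i x\<close> is \<open>u\<^sub>i\<^sup>T x\<close>, where \<open>u\<^sub>1, u\<^sub>2, \<dots>\<close> are the columns of \<open>U\<close>.\<close>

definition coeff_col :: "real mat \<Rightarrow> nat \<Rightarrow> real vec \<Rightarrow> real" where
  "coeff_col U i x = scalar_prod (col U (i - 1)) x"

definition lanczos_bidiag ::
  "real mat \<Rightarrow> real vec \<Rightarrow> nat \<Rightarrow> (nat \<Rightarrow> real vec) \<Rightarrow> (nat \<Rightarrow> real vec)
     \<Rightarrow> (nat \<Rightarrow> real) \<Rightarrow> (nat \<Rightarrow> real) \<Rightarrow> bool" where
  "lanczos_bidiag A b N p q la lb \<longleftrightarrow>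
     p 1 = (1 / vec_norm2 b) \<cdot>\<^sub>v b \<and>
     lb 1 \<cdot>\<^sub>v q 0 = 0\<^sub>v (dim_col A) \<and>
     (\<forall>j\<in>{1..N}.
        (let r = transpose_mat A *\<^sub>v p j - lb j \<cdot>\<^sub>v q (j - 1)
         in la j = vec_norm2 r \<and> q j = (1 / la j) \<cdot>\<^sub>v r) \<and>
        (let z = A *\<^sub>v q j - la j \<cdot>\<^sub>v p j
         in lb (j + 1) = vec_norm2 z \<and> p (j + 1) = (1 / lb (j + 1)) \<cdot>\<^sub>v z))"

text \<open>\<open>B\<^sub>k = P\<^bsub>k+1\<^esub>\<^sup>T A Q\<^sub>k\<close>\<close>

definition lanczos_B ::
  "real mat \<Rightarrow> (nat \<Rightarrow> real vec) \<Rightarrow> (nat \<Rightarrow> real vec) \<Rightarrow> nat \<Rightarrow> real mat" where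
  "lanczos_B A p q k =
     transpose_mat (mat_of_cols (dim_row A) (map p [1..<k + 2])) * A
       * mat_of_cols (dim_col A) (map q [1..<k + 1])"

text \<open>The inverse of an invertible square matrix; unspecified otherwise.\<close>

definition minv :: "real mat \<Rightarrow> real mat" where
  "minv M = the (mat_inverse M)"

text \<open>\<open>D = diag(\<sigma>\<^sub>i u\<^sub>i\<^sup>T b)\<close>, and \<open>T\<^sub>k\<close> with \<open>i\<close>-th row \<open>(1, \<sigma>\<^sub>i\<^sup>2, \<dots>, \<sigma>\<^sub>i\<^bsup>2k-2\<^esup>)\<close>.\<close>

definition D_mat :: "nat \<Rightarrow> (nat \<Rightarrow> real) \<Rightarrow> real mat \<Rightarrow> real vec \<Rightarrow> real mat" where
  "D_mat n \<sigma> U b = mat_diag n (\<lambda>i. \<sigma> (i + 1) * coeff_col U (i + 1) b)"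

definition T_mat :: "nat \<Rightarrow> (nat \<Rightarrow> real) \<Rightarrow> nat \<Rightarrow> real mat" where
  "T_mat n \<sigma> k = mat n k (\<lambda>(i, j). \<sigma> (i + 1) ^ (2 * j))"

definition Delta_mat :: "nat \<Rightarrow> (nat \<Rightarrow> real) \<Rightarrow> real mat \<Rightarrow> real vec \<Rightarrow> nat \<Rightarrow> real mat" where
  "Delta_mat n \<sigma> U b k =
     (let D = D_mat n \<sigma> U b;
          T = T_mat n \<sigma> k;
          D1 = mat k k (\<lambda>(i, j). D $$ (i, j));
          D2 = mat (n - k) (n - k) (\<lambda>(i, j). D $$ (k + i, k + j));
          T1 = mat k k (\<lambda>(i, j). T $$ (i, j));
          T2 = mat (n - k) k (\<lambda>(i, j). T $$ (k + i, j))
      in D2 * T2 * minv T1 * minv D1)"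

text \<open>The nonnegative solution \<open>\<eta>\<^sub>k\<close> of
  \<open>\<eta>\<^sub>k\<^sup>2 \<sigma>\<^bsub>k+1\<^esub>\<^sup>2 = \<parallel>\<Sigma>\<^sub>k (I + \<Delta>\<^sub>k\<^sup>T \<Delta>\<^sub>k)\<^sup>-\<^sup>1 \<Delta>\<^sub>k\<^sup>T \<Delta>\<^sub>k\<parallel>\<^sup>2 + \<parallel>\<Sigma>\<^sub>k (I + \<Delta>\<^sub>k\<^sup>T \<Delta>\<^sub>k)\<^sup>-\<^sup>1 \<Delta>\<^sub>k\<^sup>T\<parallel>\<^sup>2\<close>.\<close>

definition eta_k :: "nat \<Rightarrow> (nat \<Rightarrow> real) \<Rightarrow> real mat \<Rightarrow> real vec \<Rightarrow> nat \<Rightarrow> real" where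
  "eta_k n \<sigma> U b k =
     (let \<Delta> = Delta_mat n \<sigma> U b k;
          \<Delta>T = transpose_mat \<Delta>;
          S = mat_diag k (\<lambda>i. \<sigma> (i + 1)) * minv (1\<^sub>m k + \<Delta>T * \<Delta>)
      in sqrt ((mat_norm2 (S * (\<Delta>T * \<Delta>)))\<^sup>2 + (mat_norm2 (S * \<Delta>T))\<^sup>2) / \<sigma> (k + 1))"

definition severely_ill_posed :: "nat \<Rightarrow> (nat \<Rightarrow> real) \<Rightarrow> real \<Rightarrow> real \<Rightarrow> bool" where
  "severely_ill_posed n \<sigma> \<zeta> \<rho> \<longleftrightarrow> \<zeta> > 0 \<and> \<rho> > 1 \<and> (\<forall>i\<in>{1..n}. \<sigma> i = \<zeta> * \<rho> powr (- real i))"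

definition moderately_ill_posed :: "nat \<Rightarrow> (nat \<Rightarrow> real) \<Rightarrow> real \<Rightarrow> real \<Rightarrow> bool" where
  "moderately_ill_posed n \<sigma> \<zeta> \<alpha> \<longleftrightarrow> \<zeta> > 0 \<and> \<alpha> > 1 \<and> (\<forall>i\<in>{1..n}. \<sigma> i = \<zeta> * real i powr (- \<alpha>))"

text \<open>
  The discrete Picard condition for \<open>b = bhat + e\<close> with noise level \<open>\<eta>\<close> and transition index
  \<open>k0\<close>.  The relations "approximately equal" that describe white noise are idealized to
  equalities on the coefficients of \<open>b\<close>.  They are deliberately not also imposed on \<open>e\<close>:
  exact equality there would contradict the other equalities.
\<close>

definition discrete_picard ::
  "nat \<Rightarrow> (nat \<Rightarrow> real) \<Rightarrow> real mat \<Rightarrow> real vec \<Rightarrow> real vec \<Rightarrow> real vec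
     \<Rightarrow> real \<Rightarrow> real \<Rightarrow> nat \<Rightarrow> bool" where
  "discrete_picard n \<sigma> U b bhat e \<beta> \<eta> k0 \<longleftrightarrow>
     \<beta> > 0 \<and> \<eta> > 0 \<and> 1 \<le> k0 \<and> k0 + 1 \<le> n \<and>
     bhat \<in> carrier_vec (dim_row U) \<and> e \<in> carrier_vec (dim_row U) \<and> b = bhat + e \<and>
     (\<forall>i\<in>{1..n}. \<bar>coeff_col U i bhat\<bar> = \<sigma> i powr (1 + \<beta>)) \<and>
     \<bar>coeff_col U k0 bhat\<bar> > \<eta> \<and>
     (\<forall>j\<in>{1..k0}. \<bar>coeff_col U j b\<bar> = \<sigma> j powr (1 + \<beta>)) \<and>
     (\<forall>j\<in>{k0 + 1..n}. \<bar>coeff_col U j b\<bar> = \<eta>) \<and>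
     (\<forall>j\<in>{1..n - 1}. \<bar>coeff_col U (j + 1) b\<bar> \<le> \<bar>coeff_col U j b\<bar>) \<and>
     (\<forall>k\<in>{1..k0}. \<bar>coeff_col U (k + 1) b\<bar> / \<bar>coeff_col U k b\<bar> = (\<sigma> (k + 1) / \<sigma> k) powr (1 + \<beta>)) \<and>
     (\<forall>k\<in>{k0 + 1..n - 1}. \<bar>coeff_col U (k + 1) b\<bar> / \<bar>coeff_col U k b\<bar> = 1)"

end

theory Submission
  imports Defs "HOL-Analysis.L2_Norm" "HOL-Computational_Algebra.Polynomial"
    "Jordan_Normal_Form.Determinant"
begin

text \<open>The argument takes place in the coordinates of the right singular vectors of \<open>A\<close>.  There the
  range of \<open>Q\<^sub>k\<close> is the Krylov space of all vectors with entries
  \<open>\<sigma>\<^sub>i u\<^sub>i\<^sup>T b \<cdot> p (\<sigma>\<^sub>i\<^sup>2)\<close>, \<open>p\<close> a polynomial of degree below \<open>k\<close>, and \<open>B\<^sub>k\<^sup>T B\<^sub>k\<close> is the compression of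
  \<open>A\<^sup>T A\<close> to this space.  The right singular vectors of \<open>B\<^sub>k\<close> thus give \<open>k\<close> Ritz vectors which are
  orthonormal and also orthogonal for \<open>A\<^sup>T A\<close>, with the squared Ritz values on the diagonal.  The locale
  \<open>ritz_system\<close> records exactly this, and \<open>ritz_system_lanczos\<close> derives it from the Lanczos process.
  The bounds on the Ritz values compare quadratic forms on suitable subspaces, in each case through one
  vector obtained by counting dimensions (\<open>exists_vec_annihilated\<close>).

  \<^bold>\<open>Ritz values lie below.\<close>  The min-max comparison gives \<open>\<theta>\<^sub>i \<le> \<sigma>\<^sub>i\<close>.  Equality would put a
  singular vector of \<open>A\<close> into the Krylov space, that is, produce a nonzero polynomial of degree below
  \<open>k\<close> with \<open>n - 1 \<ge> k\<close> roots (\<open>ritz_less\<close>).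

  \<^bold>\<open>Ritz values lie near.\<close>  Weyl's inequality bounds \<open>\<sigma>\<^sub>i - \<theta>\<^sub>i\<close> by the norm of \<open>A (I - \<Pi>)\<close>, where
  \<open>\<Pi>\<close> is the orthogonal projection onto the Krylov space (\<open>ritz_near\<close>).  This space is the graph of
  \<open>\<Delta>\<^sub>k\<close> (\<open>tail_eq_Delta_head\<close>), so \<open>\<Pi>\<close> has an explicit block form.  The first \<open>k\<close> rows of
  \<open>\<Sigma> (I - \<Pi>)\<close> are the two blocks that define \<open>\<eta>\<^sub>k\<close> (\<open>top_residual\<close>), and in the other rows the
  singular values are at most \<open>\<sigma>\<^bsub>k+1\<^esub>\<close>.  Together the squared norm is at most
  \<open>\<eta>\<^sub>k\<^sup>2 \<sigma>\<^bsub>k+1\<^esub>\<^sup>2 + \<sigma>\<^bsub>k+1\<^esub>\<^sup>2\<close>.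

  \<^bold>\<open>Interlacing.\<close>  In the moderately ill-posed case the condition on \<open>\<alpha>\<close> implies that
  \<open>\<sigma>\<^sub>i - \<sigma>\<^bsub>i+1\<^esub>\<close> exceeds that bound, so \<open>\<theta>\<^sub>i > \<sigma>\<^bsub>i+1\<^esub>\<close>.  In the severely ill-posed case
  \<open>\<rho> \<ge> 1 + \<surd>2\<close> gives \<open>\<rho>\<^sup>2 \<ge> 5\<close>, so the mass of a Krylov vector concentrates in its
  first coordinates: Lagrange interpolation at \<open>\<sigma>\<^sub>1\<^sup>2, \<dots>, \<sigma>\<^sub>k\<^sup>2\<close> shows that in every Krylov vector the coordinates beyond \<open>k\<close> carry
  at most \<open>5/9\<close> of the mass of the first \<open>k\<close> (\<open>geometric_tail\<close>).  A second min-max comparison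
  (\<open>ritz_ge_if_tail_small\<close>) then yields
  \<open>\<theta>\<^sub>i\<^sup>2 \<ge> 9/14 \<sigma>\<^sub>i\<^sup>2 > \<sigma>\<^sub>i\<^sup>2 / \<rho>\<^sup>2 = \<sigma>\<^bsub>i+1\<^esub>\<^sup>2\<close>.\<close>

section \<open>Norms, quadratic forms and linear systems\<close>

lemma vec_norm2_L2_set: "vec_norm2 x = L2_set (\<lambda>i. x $ i) {..<dim_vec x}"
  unfolding vec_norm2_def L2_set_def scalar_prod_def
  by (simp add: power2_eq_square atLeast0LessThan)

lemma power2_vec_norm2: "(vec_norm2 x)\<^sup>2 = (\<Sum>i<dim_vec x. (x $ i)\<^sup>2)"
  unfolding vec_norm2_L2_set L2_set_def by (simp add: sum_nonneg)

lemma vec_norm2_nonneg [simp]: "0 \<le> vec_norm2 x"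
  unfolding vec_norm2_L2_set by (rule L2_set_nonneg)

lemma vec_norm2_smult: "vec_norm2 (a \<cdot>\<^sub>v x) = \<bar>a\<bar> * vec_norm2 x"
proof -
  have "(\<Sum>i<dim_vec x. ((a \<cdot>\<^sub>v x) $ i)\<^sup>2) = a\<^sup>2 * (\<Sum>i<dim_vec x. (x $ i)\<^sup>2)"
    unfolding sum_distrib_left by (rule sum.cong) (auto simp: power_mult_distrib)
  then show ?thesis
    unfolding vec_norm2_L2_set L2_set_def by (simp add: real_sqrt_mult)
qed

lemma abs_scalar_prod_le:
  assumes "dim_vec x = dim_vec y"
  shows "\<bar>x \<bullet> y\<bar> \<le> vec_norm2 x * vec_norm2 y"
proof -
  have "\<bar>x \<bullet> y\<bar> \<le> (\<Sum>i<dim_vec y. \<bar>x $ i\<bar> * \<bar>y $ i\<bar>)"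
    unfolding scalar_prod_def atLeast0LessThan by (rule order_trans[OF sum_abs]) (simp add: abs_mult)
  also have "\<dots> \<le> vec_norm2 x * vec_norm2 y"
    unfolding vec_norm2_L2_set assms by (rule L2_set_mult_ineq)
  finally show ?thesis .
qed

lemma vec_norm2_add_le:
  assumes "x \<in> carrier_vec N" "y \<in> carrier_vec N"
  shows "vec_norm2 (x + y) \<le> vec_norm2 x + vec_norm2 y"
proof -
  have "vec_norm2 (x + y) = L2_set (\<lambda>i. x $ i + y $ i) {..<N}"
    unfolding vec_norm2_L2_set L2_set_def using assms by auto
  also have "\<dots> \<le> vec_norm2 x + vec_norm2 y"
    unfolding vec_norm2_L2_set using assms L2_set_triangle_ineq[of "\<lambda>i. x $ i" "\<lambda>i. y $ i"] by auto
  finally show ?thesis .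
qed

lemma vec_norm2_minus_le:
  assumes "x \<in> carrier_vec N" "y \<in> carrier_vec N"
  shows "vec_norm2 (x - y) \<le> vec_norm2 x + vec_norm2 y"
proof -
  have "x - y = x + (-1) \<cdot>\<^sub>v y"
    using assms by (intro eq_vecI) auto
  then show ?thesis
    using vec_norm2_add_le[OF assms(1), of "(-1) \<cdot>\<^sub>v y"] assms by (simp add: vec_norm2_smult)
qed

lemma vec_norm2_eq_0_iff:
  assumes "x \<in> carrier_vec N"
  shows "vec_norm2 x = 0 \<longleftrightarrow> x = 0\<^sub>v N"
  unfolding vec_norm2_L2_set using assms by (auto simp: L2_set_eq_0_iff)

lemma vec_norm2_pos:
  assumes "x \<in> carrier_vec N" "x \<noteq> 0\<^sub>v N"
  shows "0 < vec_norm2 x"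
  using vec_norm2_eq_0_iff[OF assms(1)] assms(2) vec_norm2_nonneg[of x] by linarith

lemma sum_power2_pos:
  assumes "w \<in> carrier_vec N" "w \<noteq> 0\<^sub>v N"
  shows "0 < (\<Sum>j<N. (w $ j)\<^sup>2 :: real)"
  using vec_norm2_pos[OF assms] power2_vec_norm2[of w] assms(1)
  by (metis carrier_vecD zero_less_power)

text \<open>The supremum defining \<^const>\<open>mat_norm2\<close> ranges over a bounded set, by Cauchy-Schwarz for each row;
  without that bound its value would carry no information.\<close>

lemma vec_norm2_mult_mat_vec_le:
  assumes M: "M \<in> carrier_mat nr nc" and x: "x \<in> carrier_vec nc"
  shows "vec_norm2 (M *\<^sub>v x) \<le> mat_norm2 M * vec_norm2 x"
proof (cases "x = 0\<^sub>v nc")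
  case True
  then have "M *\<^sub>v x = 0\<^sub>v nr"
    using M by (intro eq_vecI) auto
  then show ?thesis
    using True vec_norm2_eq_0_iff[of "0\<^sub>v nr" nr] vec_norm2_eq_0_iff[of "0\<^sub>v nc" nc] by simp
next
  case False
  let ?S = "{y \<in> carrier_vec (dim_col M). vec_norm2 y \<le> 1}"
  have bdd: "bdd_above ((\<lambda>y. vec_norm2 (M *\<^sub>v y)) ` ?S)"
  proof (rule bdd_aboveI2)
    fix y assume y: "y \<in> ?S"
    have le: "\<bar>(M *\<^sub>v y) $ i\<bar> \<le> vec_norm2 (row M i)" if "i < dim_row M" for i
    proof -
      have "\<bar>(M *\<^sub>v y) $ i\<bar> \<le> vec_norm2 (row M i) * vec_norm2 y"
        using that y abs_scalar_prod_le[of "row M i" y] carrier_vecD[of y "dim_col M"] by auto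
      also have "\<dots> \<le> vec_norm2 (row M i) * 1"
        using y by (intro mult_left_mono) auto
      finally show ?thesis by simp
    qed
    have "vec_norm2 (M *\<^sub>v y) \<le> (\<Sum>i<dim_row M. \<bar>(M *\<^sub>v y) $ i\<bar>)"
      unfolding vec_norm2_L2_set dim_mult_mat_vec by (rule L2_set_le_sum_abs)
    also have "\<dots> \<le> (\<Sum>i<dim_row M. vec_norm2 (row M i))"
      using le by (intro sum_mono) simp
    finally show "vec_norm2 (M *\<^sub>v y) \<le> (\<Sum>i<dim_row M. vec_norm2 (row M i))" .
  qed
  have pos: "0 < vec_norm2 x"
    using vec_norm2_pos[OF x False] .
  define y where "y = (1 / vec_norm2 x) \<cdot>\<^sub>v x"
  have "y \<in> ?S"
    unfolding y_def using x M pos by (auto simp: vec_norm2_smult)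
  then have "vec_norm2 (M *\<^sub>v y) \<le> mat_norm2 M"
    unfolding mat_norm2_def using bdd by (intro cSUP_upper)
  moreover have "vec_norm2 (M *\<^sub>v y) = vec_norm2 (M *\<^sub>v x) / vec_norm2 x"
    unfolding y_def using M x pos by (subst mult_mat_vec[OF M x]) (simp add: vec_norm2_smult)
  ultimately show ?thesis
    using pos by (simp add: field_simps)
qed

lemma mult_mat_vec_index:
  assumes "M \<in> carrier_mat nr nc" "x \<in> carrier_vec nc" "i < nr"
  shows "(M *\<^sub>v x) $ i = (\<Sum>j<nc. M $$ (i, j) * x $ j)"
  using assms by (auto simp: scalar_prod_def atLeast0LessThan intro!: sum.cong)

lemma mat_diag_mult_vec:
  assumes "x \<in> carrier_vec N"
  shows "mat_diag N f *\<^sub>v x = vec N (\<lambda>i. f i * x $ i)"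
proof (rule eq_vecI)
  fix i assume "i < dim_vec (vec N (\<lambda>i. f i * x $ i))"
  then have i: "i < N" by simp
  have "(mat_diag N f *\<^sub>v x) $ i = (\<Sum>j<N. mat_diag N f $$ (i, j) * x $ j)"
    using assms i by (intro mult_mat_vec_index) auto
  also have "\<dots> = (\<Sum>j<N. if j = i then f i * x $ i else 0)"
    using i by (intro sum.cong) (auto simp: mat_diag_def)
  finally show "(mat_diag N f *\<^sub>v x) $ i = vec N (\<lambda>i. f i * x $ i) $ i"
    using i by simp
qed (simp add: mat_diag_def)

lemma quadratic_form_mat_diag:
  fixes f g :: "nat \<Rightarrow> real"
  assumes X: "X \<in> carrier_mat N K"
    and XX: "transpose_mat X * mat_diag N f * X = mat_diag K g"
    and w: "w \<in> carrier_vec K"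
  shows "(\<Sum>i<N. f i * ((X *\<^sub>v w) $ i)\<^sup>2) = (\<Sum>j<K. g j * (w $ j)\<^sup>2)"
proof -
  have Xw: "X *\<^sub>v w \<in> carrier_vec N" and XT: "transpose_mat X \<in> carrier_mat K N"
    using X w by simp_all
  have "(\<Sum>i<N. f i * ((X *\<^sub>v w) $ i)\<^sup>2) = (X *\<^sub>v w) \<bullet> (mat_diag N f *\<^sub>v (X *\<^sub>v w))"
    unfolding mat_diag_mult_vec[OF Xw] using X
    by (auto simp: scalar_prod_def atLeast0LessThan power2_eq_square mult_ac intro!: sum.cong)
  also have "\<dots> = (mat_diag N f *\<^sub>v (X *\<^sub>v w)) \<bullet> (X *\<^sub>v w)"
    by (rule comm_scalar_prod[OF Xw mult_mat_vec_carrier[OF mat_diag_dim Xw]])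
  also have "\<dots> = (transpose_mat X *\<^sub>v (mat_diag N f *\<^sub>v (X *\<^sub>v w))) \<bullet> w"
    by (rule transpose_vec_mult_scalar[OF X w mult_mat_vec_carrier[OF mat_diag_dim Xw], symmetric])
  also have "transpose_mat X *\<^sub>v (mat_diag N f *\<^sub>v (X *\<^sub>v w)) = (transpose_mat X * mat_diag N f * X) *\<^sub>v w"
    using assoc_mult_mat_vec[OF XT mult_carrier_mat[OF mat_diag_dim X] w]
      assoc_mult_mat_vec[OF mat_diag_dim X w] assoc_mult_mat[OF XT mat_diag_dim X] by simp
  also have "\<dots> \<bullet> w = (\<Sum>j<K. g j * (w $ j)\<^sup>2)"
    unfolding XX mat_diag_mult_vec[OF w] using w
    by (auto simp: scalar_prod_def atLeast0LessThan power2_eq_square mult_ac intro!: sum.cong)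
  finally show ?thesis .
qed

text \<open>The dimension count behind every min-max argument below: fewer than \<open>N\<close> linear conditions on
  \<open>N\<close> unknowns have a nontrivial solution.  Leaving out the condition number \<open>i\<close>, rather than
  listing \<open>N - 1\<close> of them, makes the square matrix with a zero row available; it also lets
  conditions \<open>v $ l = 0\<close> restrict the support of \<open>v\<close>.\<close>

lemma exists_vec_annihilated:
  fixes F :: "nat \<Rightarrow> real vec"
  assumes i: "i < N"
  shows "\<exists>v \<in> carrier_vec N. v \<noteq> 0\<^sub>v N \<and> (\<forall>l<N. l \<noteq> i \<longrightarrow> (\<Sum>j<N. F l $ j * v $ j) = 0)"
proof -
  define M where "M = mat N N (\<lambda>(l, j). if l = i then 0 else F l $ j)"
  have M: "M \<in> carrier_mat N N"
    unfolding M_def by simp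
  then have "transpose_mat M \<in> carrier_mat N N"
    by simp
  \<comment> \<open>Row \<open>i\<close> of \<open>M\<close> is zero, so its transpose annihilates a unit vector.\<close>
  moreover have "transpose_mat M *\<^sub>v unit_vec N i = 0\<^sub>v N"
    using i by (intro eq_vecI) (auto simp: M_def)
  moreover have "unit_vec N i \<noteq> (0\<^sub>v N :: real vec)"
    using i by simp
  ultimately have "det (transpose_mat M) = 0"
    using det_0_iff_vec_prod_zero[of "transpose_mat M" N] unit_vec_carrier[of N i] by blast
  then have "det M = 0"
    using det_transpose[OF M] by simp
  then obtain v where v: "v \<in> carrier_vec N" "v \<noteq> 0\<^sub>v N" "M *\<^sub>v v = 0\<^sub>v N"
    using det_0_iff_vec_prod_zero[OF M] by auto
  have "(\<Sum>j<N. F l $ j * v $ j) = 0" if "l < N" "l \<noteq> i" for l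
  proof -
    have "(\<Sum>j<N. F l $ j * v $ j) = (M *\<^sub>v v) $ l"
      using that v(1) unfolding mult_mat_vec_index[OF M v(1) that(1)] by (intro sum.cong) (auto simp: M_def)
    then show ?thesis
      using v(3) that by simp
  qed
  then show ?thesis
    using v by auto
qed

lemma minv_eqI:
  assumes M: "M \<in> carrier_mat N N" and X: "X \<in> carrier_mat N N" and XM: "X * M = 1\<^sub>m N"
  shows "minv M = X"
proof -
  have MX: "M * X = 1\<^sub>m N"
    using mat_mult_left_right_inverse[OF X M XM] .
  have "M \<in> Units (ring_mat TYPE(real) N ())"
    unfolding Units_def using M X XM MX by (auto simp: ring_mat_simps)
  then obtain Y where Y: "mat_inverse M = Some Y"
    using mat_inverse(1)[OF M, of "()"] by (cases "mat_inverse M") auto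
  then have "M * Y = 1\<^sub>m N" "Y \<in> carrier_mat N N"
    using mat_inverse(2)[OF M Y] by auto
  then have "X * (M * Y) = X" "X * (M * Y) = X * M * Y"
    using X M by (auto simp: assoc_mult_mat[of _ N N])
  then have "Y = X"
    using XM \<open>Y \<in> carrier_mat N N\<close> by simp
  then show ?thesis
    using Y by (simp add: minv_def)
qed

lemma minv_mult_self:
  assumes M: "M \<in> carrier_mat N N" and inj: "\<And>v. v \<in> carrier_vec N \<Longrightarrow> M *\<^sub>v v = 0\<^sub>v N \<Longrightarrow> v = 0\<^sub>v N"
  shows "minv M * M = 1\<^sub>m N" and "minv M \<in> carrier_mat N N"
proof -
  have "det M \<noteq> 0"
    using det_0_iff_vec_prod_zero[OF M] inj by auto
  then have "M \<in> Units (ring_mat TYPE(real) N ())"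
    using det_non_zero_imp_unit[OF M] by auto
  then obtain Y where Y: "mat_inverse M = Some Y"
    using mat_inverse(1)[OF M, of "()"] by (cases "mat_inverse M") auto
  then show "minv M * M = 1\<^sub>m N" "minv M \<in> carrier_mat N N"
    using mat_inverse(2)[OF M Y] by (auto simp: minv_def)
qed

section \<open>Polynomial interpolation\<close>

lemma poly_eq_0_if_many_roots:
  fixes p :: "real poly"
  assumes "finite S" "\<And>x. x \<in> S \<Longrightarrow> poly p x = 0" "degree p < card S"
  shows "p = 0"
proof (rule ccontr)
  assume "p \<noteq> 0"
  then have "card {x. poly p x = 0} \<le> degree p"
    by (rule card_poly_roots_bound)
  moreover have "card S \<le> card {x. poly p x = 0}"
    using assms(2) poly_roots_finite[OF \<open>p \<noteq> 0\<close>] by (intro card_mono) auto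
  ultimately show False
    using assms(3) by simp
qed

lemma lagrange_interpolation:
  fixes x :: "nat \<Rightarrow> real"
  assumes inj: "inj_on x {..<k}" and deg: "degree p < k"
  shows "poly p z = (\<Sum>j<k. poly p (x j) * (\<Prod>l\<in>{..<k} - {j}. (z - x l) / (x j - x l)))"
proof -
  define B where "B j = (\<Prod>l\<in>{..<k} - {j}. [:- (x l / (x j - x l)), 1 / (x j - x l):])" for j
  have B: "poly (B j) z = (\<Prod>l\<in>{..<k} - {j}. (z - x l) / (x j - x l))" for j z
    unfolding B_def poly_prod by (simp add: diff_divide_distrib)
  have B_node: "poly (B j) (x i) = (if i = j then 1 else 0)" if "i < k" "j < k" for i j
  proof (cases "i = j")
    case True
    have "x j - x l \<noteq> 0" if "l \<in> {..<k} - {j}" for l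
      using inj that \<open>j < k\<close> by (auto simp: inj_on_def)
    then show ?thesis
      unfolding B using True by (auto intro!: prod.neutral)
  next
    case False
    then show ?thesis
      unfolding B using that by (auto intro!: prod_zero bexI[of _ i])
  qed
  have B_deg: "degree (B j) \<le> k - 1" if "j < k" for j
  proof -
    have "degree (B j) \<le> (\<Sum>l\<in>{..<k} - {j}. degree [:- (x l / (x j - x l)), 1 / (x j - x l):])"
      unfolding B_def by (rule order_trans[OF degree_prod_sum_le]) (auto simp: o_def)
    also have "\<dots> \<le> (\<Sum>l\<in>{..<k} - {j}. 1)"
      by (intro sum_mono) simp
    finally show ?thesis
      using that by simp
  qed
  define p' where "p' = p - (\<Sum>j<k. smult (poly p (x j)) (B j))"
  have "p' = 0"
  proof (rule poly_eq_0_if_many_roots[of "x ` {..<k}"])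
    show "poly p' y = 0" if y: "y \<in> x ` {..<k}" for y
    proof -
      obtain i where i: "i < k" "y = x i"
        using y by auto
      have "(\<Sum>j<k. poly p (x j) * poly (B j) (x i)) = (\<Sum>j<k. if j = i then poly p (x j) else 0)"
        using i(1) by (intro sum.cong) (auto simp: B_node)
      then show ?thesis
        unfolding p'_def i(2) using i(1) by (simp add: poly_sum)
    qed
    have "degree (\<Sum>j<k. smult (poly p (x j)) (B j)) \<le> k - 1"
      using B_deg by (intro degree_sum_le) (auto intro!: order_trans[OF degree_smult_le])
    then have "degree p' \<le> k - 1"
      unfolding p'_def using deg by (intro degree_diff_le) auto
    then show "degree p' < card (x ` {..<k})"
      using deg card_image[OF inj] by simp
  qed simp
  then have "poly p z = poly (\<Sum>j<k. smult (poly p (x j)) (B j)) z"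
    unfolding p'_def by simp
  then show ?thesis
    by (simp add: poly_sum B)
qed

lemma one_minus_sum_le_prod:
  fixes a :: "'a \<Rightarrow> real"
  assumes "finite S" "\<And>i. i \<in> S \<Longrightarrow> 0 \<le> a i \<and> a i \<le> 1"
  shows "1 - sum a S \<le> (\<Prod>i\<in>S. 1 - a i)"
  using assms
proof (induction S rule: finite_induct)
  case (insert i S)
  have "(\<Prod>i\<in>S. 1 - a i) \<le> 1"
    using insert.prems by (intro prod_le_1) auto
  then have "a i * (\<Prod>i\<in>S. 1 - a i) \<le> a i"
    using insert.prems[of i] by (intro mult_left_le) auto
  then show ?case
    using insert by (auto simp: left_diff_distrib)
qed simp

text \<open>The two geometric sums that occur for a squared ratio \<open>q \<le> 1/5\<close>.  A recursion in \<open>j\<close> with a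
  fixed bound replaces the closed forms \<open>q / (1 - q)\<close> and \<open>1 / (1 - q)\<close>.\<close>

lemma sum_power_le_quarter:
  fixes q :: real
  assumes "0 \<le> q" "q \<le> 1/5"
  shows "(\<Sum>l<j. q ^ (j - l)) \<le> 1/4"
proof (induction j)
  case (Suc j)
  have "(\<Sum>l<Suc j. q ^ (Suc j - l)) = q * (\<Sum>l<j. q ^ (j - l)) + q"
    by (simp add: sum_distrib_left Suc_diff_le)
  also have "\<dots> \<le> q * (1/4) + q"
    using Suc assms by (intro add_right_mono mult_left_mono) auto
  finally show ?case
    using assms by simp
qed simp

lemma sum_power_le_five_quarters:
  fixes q :: real
  assumes "0 \<le> q" "q \<le> 1/5"
  shows "(\<Sum>l<j. q ^ l) \<le> 5/4"
proof (induction j)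
  case (Suc j)
  have "(\<Sum>l<Suc j. q ^ l) = q * (\<Sum>l<j. q ^ l) + 1"
    by (simp add: sum_distrib_left sum.lessThan_Suc_shift del: sum.lessThan_Suc)
  also have "\<dots> \<le> q * (5/4) + 1"
    using Suc assms by (intro add_right_mono mult_left_mono) auto
  finally show ?case
    using assms by simp
qed simp

text \<open>A Lagrange basis polynomial on geometric nodes stays bounded below all nodes, whatever their
  number: a node \<open>l > j\<close> contributes a factor at most 1, and the nodes \<open>l < j\<close> together
  at most \<open>1 / \<Prod>(1 - q\<^bsup>j-l\<^esup>)\<close>, where the product is at least \<open>1 - \<Sum> q\<^bsup>j-l\<^esup> \<ge> 3/4\<close>.\<close>

lemma geometric_lagrange_le:
  fixes q a :: real
  assumes q: "0 < q" "q \<le> 1/5" and a: "0 < a" and i: "k \<le> i" and j: "j < k"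
  shows "\<bar>\<Prod>l\<in>{..<k} - {j}. (a * q ^ i - a * q ^ l) / (a * q ^ j - a * q ^ l)\<bar> \<le> 4/3"
proof -
  have factor: "\<bar>(a * q ^ i - a * q ^ l) / (a * q ^ j - a * q ^ l)\<bar> \<le> (if l < j then 1 / (1 - q ^ (j - l)) else 1)"
    if l: "l \<in> {..<k} - {j}" for l
  proof -
    have "(a * q ^ i - a * q ^ l) / (a * q ^ j - a * q ^ l) = (q ^ i - q ^ l) / (q ^ j - q ^ l)"
      using a by (simp add: right_diff_distrib[symmetric])
    moreover have il: "\<bar>q ^ i - q ^ l\<bar> \<le> q ^ l"
      using l i q power_decreasing[of l i q] zero_less_power[OF q(1), of i] by (simp add: abs_le_iff)
    ultimately have le: "\<bar>(a * q ^ i - a * q ^ l) / (a * q ^ j - a * q ^ l)\<bar> \<le> q ^ l / \<bar>q ^ j - q ^ l\<bar>"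
      by (simp add: abs_divide divide_right_mono)
    show ?thesis
    proof (cases "l < j")
      case True
      have "q ^ j = q ^ l * q ^ (j - l)"
        using True by (simp add: power_add[symmetric])
      moreover have "q ^ (j - l) < 1"
      proof -
        have "q ^ (j - l) \<le> q ^ 1"
          using True q by (intro power_decreasing) auto
        then show ?thesis
          using q by simp
      qed
      ultimately have "q ^ l - q ^ j = q ^ l * (1 - q ^ (j - l))" "0 < 1 - q ^ (j - l)"
        by (simp_all only: right_diff_distrib mult_1_right diff_gt_0_iff_gt)
      moreover have "0 < q ^ l"
        using q by simp
      ultimately have "q ^ l - q ^ j = q ^ l * (1 - q ^ (j - l))" "0 < q ^ l * (1 - q ^ (j - l))"
        by (simp_all only: mult_pos_pos)
      then have "q ^ l / \<bar>q ^ j - q ^ l\<bar> = q ^ l / (q ^ l * (1 - q ^ (j - l)))"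
        by (simp only: abs_minus_commute[of "q ^ j"] abs_of_pos)
      also have "\<dots> = 1 / (1 - q ^ (j - l))"
        using q by simp
      finally show ?thesis
        using le True by (simp only: if_True)
    next
      case False
      then have "Suc j \<le> l"
        using l by auto
      then have "q ^ l \<le> q ^ Suc j"
        using q by (intro power_decreasing) auto
      moreover have "q ^ Suc j \<le> 1/5 * q ^ j"
        using q by simp
      moreover have "0 < q ^ l"
        using q by simp
      ultimately have "q ^ l \<le> \<bar>q ^ j - q ^ l\<bar>" and "0 < \<bar>q ^ j - q ^ l\<bar>"
        by linarith+
      then have "q ^ l / \<bar>q ^ j - q ^ l\<bar> \<le> 1"
        by (simp only: divide_le_eq_1_pos)
      then show ?thesis
        using le False by (simp only: if_False)
    qed
  qed
  have "\<bar>\<Prod>l\<in>{..<k} - {j}. (a * q ^ i - a * q ^ l) / (a * q ^ j - a * q ^ l)\<bar>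
      \<le> (\<Prod>l\<in>{..<k} - {j}. if l < j then 1 / (1 - q ^ (j - l)) else 1)"
    unfolding abs_prod using factor by (intro prod_mono) auto
  also have "\<dots> = (\<Prod>l<j. 1 / (1 - q ^ (j - l)))"
    using j by (intro prod.mono_neutral_cong_right) auto
  also have "\<dots> = 1 / (\<Prod>l<j. 1 - q ^ (j - l))"
    by (simp add: prod_dividef)
  also have "\<dots> \<le> 4/3"
  proof -
    have "1 - (\<Sum>l<j. q ^ (j - l)) \<le> (\<Prod>l<j. 1 - q ^ (j - l))"
      using q by (intro one_minus_sum_le_prod) (auto intro: power_le_one)
    then have "3/4 \<le> (\<Prod>l<j. 1 - q ^ (j - l))"
      using sum_power_le_quarter[of q j] q by simp
    then show ?thesis
      by (simp add: divide_le_eq)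
  qed
  finally show ?thesis .
qed

section \<open>Ritz values of a diagonal form on a Krylov space\<close>

text \<open>A Ritz system in the coordinates of the right singular vectors.  The columns of \<open>W\<close> are the
  Ritz vectors: orthonormal, and orthogonal for the form with matrix \<open>diag (s\<^sup>2)\<close> (which is
  \<open>A\<^sup>T A\<close> in these coordinates), with Ritz values \<open>t\<close>.  Their span is the Krylov space of
  \<open>diag (s\<^sup>2)\<close> started at \<open>c\<close>.  Here \<open>s i\<close> and \<open>t j\<close> stand for \<open>\<sigma>\<^bsub>i+1\<^esub>\<close> and \<open>\<theta>\<^bsub>j+1\<^esub>\<close>, because matrix
  indices start at 0.\<close>

locale ritz_system =
  fixes n k :: nat and s t c :: "nat \<Rightarrow> real" and W :: "real mat"
  assumes k_less: "k < n"
    and W: "W \<in> carrier_mat n k"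
    and orthonormal: "transpose_mat W * W = 1\<^sub>m k"
    and energy: "transpose_mat W * mat_diag n (\<lambda>i. (s i)\<^sup>2) * W = mat_diag k (\<lambda>j. (t j)\<^sup>2)"
    and c_nonzero: "\<And>i. i < n \<Longrightarrow> c i \<noteq> 0"
    and s_pos: "\<And>i. i < n \<Longrightarrow> 0 < s i"
    and s_decreasing: "\<And>i j. i < j \<Longrightarrow> j < n \<Longrightarrow> s j < s i"
    and t_nonneg: "\<And>j. j < k \<Longrightarrow> 0 \<le> t j"
    and t_decreasing: "\<And>i j. i < j \<Longrightarrow> j < k \<Longrightarrow> t j < t i"
    and krylov: "\<And>w. w \<in> carrier_vec k \<Longrightarrow>
      \<exists>p. degree p < k \<and> (\<forall>i<n. (W *\<^sub>v w) $ i = c i * poly p ((s i)\<^sup>2))"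
begin

lemma s_le: "i \<le> j \<Longrightarrow> j < n \<Longrightarrow> s j \<le> s i"
  using s_decreasing[of i j] by (cases "i = j") auto

lemma t_le: "i \<le> j \<Longrightarrow> j < k \<Longrightarrow> t j \<le> t i"
  using t_decreasing[of i j] by (cases "i = j") auto

lemma sum_power2_W:
  assumes "w \<in> carrier_vec k"
  shows "(\<Sum>i<n. ((W *\<^sub>v w) $ i)\<^sup>2) = (\<Sum>j<k. (w $ j)\<^sup>2)"
  using quadratic_form_mat_diag[OF W _ assms, of "\<lambda>_. 1" "\<lambda>_. 1"] W orthonormal by simp

lemma sum_energy_W:
  assumes "w \<in> carrier_vec k"
  shows "(\<Sum>i<n. (s i)\<^sup>2 * ((W *\<^sub>v w) $ i)\<^sup>2) = (\<Sum>j<k. (t j)\<^sup>2 * (w $ j)\<^sup>2)"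
  using quadratic_form_mat_diag[OF W energy assms] .

lemma inj_on_power2_s:
  assumes "S \<subseteq> {..<n}"
  shows "inj_on (\<lambda>i. (s i)\<^sup>2) S"
proof (rule inj_onI)
  fix i j assume ij: "i \<in> S" "j \<in> S" "(s i)\<^sup>2 = (s j)\<^sup>2"
  then have n: "i < n" "j < n"
    using assms by auto
  then have "s i = s j"
    using ij(3) s_pos[of i] s_pos[of j] by (simp add: power2_eq_iff)
  then show "i = j"
    using s_decreasing[of i j] s_decreasing[of j i] n by (cases i j rule: linorder_cases) auto
qed

text \<open>Because the \<open>s i\<close> are distinct and the \<open>c i\<close> nonzero, each zero coordinate is a separate root of the
  polynomial of a Krylov vector, whose degree is below \<open>k\<close>.\<close>

lemma krylov_vanish:
  assumes w: "w \<in> carrier_vec k" and S: "S \<subseteq> {..<n}" "k \<le> card S"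
    and zero: "\<And>i. i \<in> S \<Longrightarrow> (W *\<^sub>v w) $ i = 0"
  shows "w = 0\<^sub>v k"
proof (rule ccontr)
  assume "w \<noteq> 0\<^sub>v k"
  then have pos: "0 < (\<Sum>i<n. ((W *\<^sub>v w) $ i)\<^sup>2)"
    using sum_power2_pos[OF w] sum_power2_W[OF w] by simp
  obtain p where p: "degree p < k" "\<And>i. i < n \<Longrightarrow> (W *\<^sub>v w) $ i = c i * poly p ((s i)\<^sup>2)"
    using krylov[OF w] by auto
  have inj: "inj_on (\<lambda>i. (s i)\<^sup>2) S"
    using inj_on_power2_s[OF S(1)] .
  have "p = 0"
  proof (rule poly_eq_0_if_many_roots)
    show "finite ((\<lambda>i. (s i)\<^sup>2) ` S)"
      using S finite_subset by blast
    show "poly p x = 0" if "x \<in> (\<lambda>i. (s i)\<^sup>2) ` S" for x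
      using that zero p(2) c_nonzero S by fastforce
    show "degree p < card ((\<lambda>i. (s i)\<^sup>2) ` S)"
      using card_image[OF inj] p(1) S(2) by simp
  qed
  then show False
    using p(2) pos by simp
qed

text \<open>Some nonzero combination of the Ritz vectors \<open>0, \<dots>, j\<close> has vanishing coordinates below \<open>j\<close>.
  Its Rayleigh quotient is at least \<open>(t j)\<^sup>2\<close> and at most \<open>(s j)\<^sup>2\<close>.  Strictness comes from the
  Krylov structure: equality would leave only the coordinate \<open>j\<close>, that is, \<open>n - 1 \<ge> k\<close> zeros.\<close>

theorem ritz_less:
  assumes j: "j < k"
  shows "t j < s j"
proof (rule ccontr)
  assume "\<not> t j < s j"
  then have tj: "s j \<le> t j" by simp
  obtain v where v: "v \<in> carrier_vec k" "v \<noteq> 0\<^sub>v k"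
    and ann: "\<And>l. l < k \<Longrightarrow> l \<noteq> j \<Longrightarrow>
      (\<Sum>i<k. (if l < j then row W l else unit_vec k l) $ i * v $ i) = 0"
    using exists_vec_annihilated[OF j, of "\<lambda>l. if l < j then row W l else unit_vec k l"] by auto
  define x where "x = W *\<^sub>v v"
  have x0: "x $ l = 0" if "l < j" for l
    using ann[of l] that j k_less W v(1) unfolding x_def
    by (simp add: scalar_prod_def atLeast0LessThan)
  have v0: "v $ l = 0" if "j < l" "l < k" for l
  proof -
    have "unit_vec k l \<bullet> v = 0"
      using ann[of l] that v(1) by (simp add: scalar_prod_def atLeast0LessThan)
    then show ?thesis
      using that v(1) by simp
  qed
  have "(t j)\<^sup>2 * (\<Sum>i<n. (x $ i)\<^sup>2) = (\<Sum>l<k. (t j)\<^sup>2 * (v $ l)\<^sup>2)"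
    unfolding x_def sum_power2_W[OF v(1)] by (rule sum_distrib_left)
  also have "\<dots> \<le> (\<Sum>l<k. (t l)\<^sup>2 * (v $ l)\<^sup>2)"
  proof (rule sum_mono)
    fix l assume l: "l \<in> {..<k}"
    show "(t j)\<^sup>2 * (v $ l)\<^sup>2 \<le> (t l)\<^sup>2 * (v $ l)\<^sup>2"
      using v0[of l] l t_le[of l j] t_nonneg[OF j] j
      by (cases "l \<le> j") (auto intro!: mult_right_mono power_mono)
  qed
  also have "\<dots> = (\<Sum>i<n. (s i)\<^sup>2 * (x $ i)\<^sup>2)"
    unfolding x_def sum_energy_W[OF v(1)] ..
  finally have le: "(\<Sum>i<n. ((t j)\<^sup>2 - (s i)\<^sup>2) * (x $ i)\<^sup>2) \<le> 0"
    by (simp add: left_diff_distrib sum_subtractf sum_distrib_left)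
  have nonneg: "0 \<le> ((t j)\<^sup>2 - (s i)\<^sup>2) * (x $ i)\<^sup>2" if "i \<in> {..<n}" for i
  proof (cases "i < j")
    case False
    then have "s i \<le> t j"
      using s_le[of j i] tj that by simp
    then show ?thesis
      using s_pos[of i] that by (simp add: power_mono)
  qed (simp add: x0)
  have "(\<Sum>i<n. ((t j)\<^sup>2 - (s i)\<^sup>2) * (x $ i)\<^sup>2) = 0"
    using le by (intro antisym sum_nonneg nonneg)
  then have eq0: "((t j)\<^sup>2 - (s i)\<^sup>2) * (x $ i)\<^sup>2 = 0" if "i < n" for i
    using sum_nonneg_eq_0_iff[of "{..<n}" "\<lambda>i. ((t j)\<^sup>2 - (s i)\<^sup>2) * (x $ i)\<^sup>2"] nonneg that
    by blast
  have "v = 0\<^sub>v k"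
  proof (rule krylov_vanish[OF v(1), of "{..<n} - {j}"])
    show "k \<le> card ({..<n} - {j})"
      using j k_less by simp
    fix i assume i: "i \<in> {..<n} - {j}"
    show "(W *\<^sub>v v) $ i = 0"
    proof (cases "i < j")
      case False
      then have "s i < t j"
        using s_decreasing[of j i] tj i by simp
      then have "(s i)\<^sup>2 < (t j)\<^sup>2"
        using s_pos[of i] i by (intro power_strict_mono) auto
      then show ?thesis
        using eq0[of i] i unfolding x_def by simp
    qed (use x0 x_def in simp)
  qed auto
  then show False
    using v(2) by simp
qed

text \<open>The opposite count: some nonzero combination of the Ritz vectors \<open>j, \<dots>, k - 1\<close> has vanishing
  coordinates strictly between \<open>j\<close> and \<open>k\<close>.  Its energy is at least \<open>(s j)\<^sup>2\<close> times the mass of the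
  coordinates up to \<open>j\<close> and at most \<open>(t j)\<^sup>2\<close> times its whole mass, which the hypothesis bounds by
  \<open>1 + \<delta>\<close> times the former.\<close>

theorem ritz_ge_if_tail_small:
  assumes j: "j < k"
    and tail: "\<And>w. w \<in> carrier_vec k \<Longrightarrow>
      (\<Sum>i = k..<n. ((W *\<^sub>v w) $ i)\<^sup>2) \<le> \<delta> * (\<Sum>i<k. ((W *\<^sub>v w) $ i)\<^sup>2)"
  shows "(s j)\<^sup>2 \<le> (1 + \<delta>) * (t j)\<^sup>2"
proof -
  obtain v where v: "v \<in> carrier_vec k" "v \<noteq> 0\<^sub>v k"
    and ann: "\<And>l. l < k \<Longrightarrow> l \<noteq> j \<Longrightarrow>
      (\<Sum>i<k. (if j < l then row W l else unit_vec k l) $ i * v $ i) = 0"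
    using exists_vec_annihilated[OF j, of "\<lambda>l. if j < l then row W l else unit_vec k l"] by auto
  define x where "x = W *\<^sub>v v"
  define H where "H = (\<Sum>i<k. (x $ i)\<^sup>2)"
  have x0: "x $ l = 0" if "j < l" "l < k" for l
    using ann[of l] that j k_less W v(1) unfolding x_def
    by (simp add: scalar_prod_def atLeast0LessThan)
  have v0: "v $ l = 0" if "l < j" for l
  proof -
    have "unit_vec k l \<bullet> v = 0"
      using ann[of l] that v(1) j by (simp add: scalar_prod_def atLeast0LessThan)
    then show ?thesis
      using that v(1) j by simp
  qed
  have split: "(\<Sum>i<n. (x $ i)\<^sup>2) = H + (\<Sum>i = k..<n. (x $ i)\<^sup>2)"
    unfolding H_def using k_less by (simp add: lessThan_atLeast0 sum.atLeastLessThan_concat)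
  then have le: "(\<Sum>i<n. (x $ i)\<^sup>2) \<le> (1 + \<delta>) * H"
    using tail[OF v(1)] unfolding x_def H_def by (simp add: distrib_right)
  have "0 < (\<Sum>i<n. (x $ i)\<^sup>2)"
    unfolding x_def using sum_power2_W[OF v(1)] sum_power2_pos[OF v] by simp
  then have "H \<noteq> 0"
    using le by auto
  then have "0 < H"
    using sum_nonneg[of "{..<k}" "\<lambda>i. (x $ i)\<^sup>2"] unfolding H_def by (metis less_eq_real_def zero_le_power2)
  have "(s j)\<^sup>2 * H = (\<Sum>i<k. (s j)\<^sup>2 * (x $ i)\<^sup>2)"
    unfolding H_def by (rule sum_distrib_left)
  also have "\<dots> \<le> (\<Sum>i<k. (s i)\<^sup>2 * (x $ i)\<^sup>2)"
  proof (rule sum_mono)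
    fix l assume l: "l \<in> {..<k}"
    show "(s j)\<^sup>2 * (x $ l)\<^sup>2 \<le> (s l)\<^sup>2 * (x $ l)\<^sup>2"
      using x0[of l] l s_le[of l j] s_pos[of j] j k_less
      by (cases "l \<le> j") (auto intro!: mult_right_mono power_mono)
  qed
  also have "\<dots> \<le> (\<Sum>i<n. (s i)\<^sup>2 * (x $ i)\<^sup>2)"
    using k_less by (intro sum_mono2) auto
  also have "\<dots> = (\<Sum>l<k. (t l)\<^sup>2 * (v $ l)\<^sup>2)"
    unfolding x_def by (rule sum_energy_W[OF v(1)])
  also have "\<dots> \<le> (\<Sum>l<k. (t j)\<^sup>2 * (v $ l)\<^sup>2)"
  proof (rule sum_mono)
    fix l assume l: "l \<in> {..<k}"
    show "(t l)\<^sup>2 * (v $ l)\<^sup>2 \<le> (t j)\<^sup>2 * (v $ l)\<^sup>2"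
      using v0[of l] l t_le[of j l] t_nonneg[of l]
      by (cases "j \<le> l") (auto intro!: mult_right_mono power_mono)
  qed
  also have "\<dots> = (t j)\<^sup>2 * (\<Sum>i<n. (x $ i)\<^sup>2)"
    unfolding x_def sum_power2_W[OF v(1)] by (rule sum_distrib_left[symmetric])
  also have "\<dots> \<le> (t j)\<^sup>2 * ((1 + \<delta>) * H)"
    by (rule mult_left_mono[OF le]) simp
  finally show ?thesis
    using \<open>0 < H\<close> by (simp add: mult_ac)
qed

definition head :: "real mat" where "head = mat k k (\<lambda>(i, j). W $$ (i, j))"
definition tail :: "real mat" where "tail = mat (n - k) k (\<lambda>(i, j). W $$ (k + i, j))"

lemma head_carrier [simp]: "head \<in> carrier_mat k k"
  and tail_carrier [simp]: "tail \<in> carrier_mat (n - k) k"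
  unfolding head_def tail_def by auto

lemma sum_split_at_k:
  fixes f :: "nat \<Rightarrow> real"
  shows "(\<Sum>i<n. f i) = (\<Sum>i<k. f i) + (\<Sum>i<n - k. f (k + i))"
  using k_less sum.atLeastLessThan_concat[of 0 k n f]
    sum.shift_bounds_nat_ivl[of f 0 k "n - k"]
  by (simp add: lessThan_atLeast0 add.commute)

context
  fixes \<Delta> :: "real mat"
  assumes Delta: "\<Delta> \<in> carrier_mat (n - k) k" and tail_eq: "tail = \<Delta> * head"
begin

text \<open>Orthonormality of \<open>W = (head; \<Delta> head)\<close> reads \<open>head\<^sup>T (I + \<Delta>\<^sup>T \<Delta>) head = I\<close>.  Since \<open>head\<close> is
  square, this already inverts \<open>I + \<Delta>\<^sup>T \<Delta>\<close> and expresses the top left block of the projection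
  \<open>W W\<^sup>T\<close> through \<open>\<Delta>\<close>.\<close>

lemma minv_gram: "minv (1\<^sub>m k + transpose_mat \<Delta> * \<Delta>) = head * transpose_mat head"
  and minv_gram_left: "head * transpose_mat head * (1\<^sub>m k + transpose_mat \<Delta> * \<Delta>) = 1\<^sub>m k"
proof -
  let ?H = "transpose_mat head" and ?D = "transpose_mat \<Delta>"
  have c: "head \<in> carrier_mat k k" "?H \<in> carrier_mat k k" "?D \<in> carrier_mat k (n - k)"
    "tail \<in> carrier_mat (n - k) k" "transpose_mat tail \<in> carrier_mat k (n - k)"
    using Delta by auto
  have DD: "?D * \<Delta> \<in> carrier_mat k k" "1\<^sub>m k + ?D * \<Delta> \<in> carrier_mat k k"
    using c Delta by auto
  have "transpose_mat tail * tail = (?H * ?D) * (\<Delta> * head)"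
    unfolding tail_eq using transpose_mult[OF Delta c(1)] by simp
  also have "\<dots> = ?H * (?D * \<Delta>) * head"
    using assoc_mult_mat[OF c(2,3) mult_carrier_mat[OF Delta c(1)]]
      assoc_mult_mat[OF c(3) Delta c(1)] assoc_mult_mat[OF c(2) DD(1) c(1)] by simp
  finally have tt: "transpose_mat tail * tail = ?H * (?D * \<Delta>) * head" .
  have "1\<^sub>m k = ?H * head + transpose_mat tail * tail"
  proof (rule eq_matI)
    fix i j assume "i < dim_row (?H * head + transpose_mat tail * tail)"
      "j < dim_col (?H * head + transpose_mat tail * tail)"
    then have ij: "i < k" "j < k"
      using c by (auto simp: tail_def)
    have "(transpose_mat W * W) $$ (i, j) = (\<Sum>l<n. W $$ (l, i) * W $$ (l, j))"
      using W ij by (auto simp: scalar_prod_def atLeast0LessThan)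
    also have "\<dots> = (?H * head + transpose_mat tail * tail) $$ (i, j)"
      unfolding sum_split_at_k using ij
      by (auto simp: scalar_prod_def atLeast0LessThan head_def tail_def)
    finally show "1\<^sub>m k $$ (i, j) = (?H * head + transpose_mat tail * tail) $$ (i, j)"
      unfolding orthonormal .
  qed (auto simp: head_def tail_def)
  also have "\<dots> = ?H * (1\<^sub>m k + ?D * \<Delta>) * head"
    unfolding tt mult_add_distrib_mat[OF c(2) one_carrier_mat DD(1)] right_mult_one_mat[OF c(2)]
    by (rule add_mult_distrib_mat[OF c(2) mult_carrier_mat[OF c(2) DD(1)] c(1), symmetric])
  finally have "?H * (1\<^sub>m k + ?D * \<Delta>) * head = 1\<^sub>m k" ..
  then have "head * (?H * (1\<^sub>m k + ?D * \<Delta>)) = 1\<^sub>m k"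
    using mat_mult_left_right_inverse[OF mult_carrier_mat[OF c(2) DD(2)] c(1)] by simp
  then show *: "head * ?H * (1\<^sub>m k + ?D * \<Delta>) = 1\<^sub>m k"
    using assoc_mult_mat[OF c(1,2) DD(2)] by simp
  show "minv (1\<^sub>m k + ?D * \<Delta>) = head * ?H"
    by (rule minv_eqI[OF DD(2) mult_carrier_mat[OF c(1,2)] *])
qed


text \<open>The first \<open>k\<close> rows of \<open>I - W W\<^sup>T\<close> are the blocks \<open>I - N\<^sup>-\<^sup>1 = N\<^sup>-\<^sup>1 \<Delta>\<^sup>T \<Delta>\<close> and \<open>- N\<^sup>-\<^sup>1 \<Delta>\<^sup>T\<close>
  with \<open>N = I + \<Delta>\<^sup>T \<Delta>\<close>; scaled by \<open>\<Sigma>\<^sub>k\<close> they are the two matrices whose norms define \<open>\<eta>\<^sub>k\<close>.\<close>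

lemma top_residual:
  assumes x: "x \<in> carrier_vec n" and i: "i < k"
  defines "S \<equiv> mat_diag k s * minv (1\<^sub>m k + transpose_mat \<Delta> * \<Delta>)"
  shows "s i * (x - W *\<^sub>v (transpose_mat W *\<^sub>v x)) $ i =
    ((S * (transpose_mat \<Delta> * \<Delta>)) *\<^sub>v vec k (\<lambda>i. x $ i)
      - (S * transpose_mat \<Delta>) *\<^sub>v vec (n - k) (\<lambda>i. x $ (k + i))) $ i"
proof -
  let ?H = "transpose_mat head" and ?D = "transpose_mat \<Delta>" and ?Z = "mat_diag k s"
  define x1 where "x1 = vec k (\<lambda>i. x $ i)"
  define x2 where "x2 = vec (n - k) (\<lambda>i. x $ (k + i))"
  have H: "head * ?H \<in> carrier_mat k k" and DD: "?D * \<Delta> \<in> carrier_mat k k"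
    using mult_carrier_mat[of head k k ?H k] mult_carrier_mat[of ?D k "n - k" \<Delta> k] Delta by auto
  have c: "head \<in> carrier_mat k k" "?H \<in> carrier_mat k k" "?D \<in> carrier_mat k (n - k)"
    "head * ?H \<in> carrier_mat k k" "?D * \<Delta> \<in> carrier_mat k k" "?Z \<in> carrier_mat k k"
    "?Z * (head * ?H) \<in> carrier_mat k k" "1\<^sub>m k + ?D * \<Delta> \<in> carrier_mat k k"
    and v: "x1 \<in> carrier_vec k" "x2 \<in> carrier_vec (n - k)"
    using Delta H DD mult_carrier_mat[OF mat_diag_dim H] unfolding x1_def x2_def by auto
  have cv: "?D *\<^sub>v x2 \<in> carrier_vec k" "(?D * \<Delta>) *\<^sub>v x1 \<in> carrier_vec k"
    "?H *\<^sub>v x1 \<in> carrier_vec k" "?H *\<^sub>v (?D *\<^sub>v x2) \<in> carrier_vec k"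
    "(head * ?H) *\<^sub>v x1 \<in> carrier_vec k"
    "(head * ?H) *\<^sub>v ((?D * \<Delta>) *\<^sub>v x1) \<in> carrier_vec k"
    "(head * ?H) *\<^sub>v (?D *\<^sub>v x2) \<in> carrier_vec k"
    by (meson c v mult_mat_vec_carrier)+
  have S: "S = ?Z * (head * ?H)"
    unfolding S_def minv_gram ..
  \<comment> \<open>By \<open>minv_gram\<close>, \<open>head * head\<^sup>T\<close> is the inverse of \<open>I + \<Delta>\<^sup>T\<Delta>\<close>.\<close>
  have inv: "(head * ?H) *\<^sub>v x1 + (head * ?H) *\<^sub>v ((?D * \<Delta>) *\<^sub>v x1) = x1"
  proof -
    have "(head * ?H) *\<^sub>v ((1\<^sub>m k + ?D * \<Delta>) *\<^sub>v x1) = x1"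
      using assoc_mult_mat_vec[OF c(4) c(8) v(1)] minv_gram_left v by simp
    moreover have "(1\<^sub>m k + ?D * \<Delta>) *\<^sub>v x1 = x1 + (?D * \<Delta>) *\<^sub>v x1"
      using add_mult_distrib_mat_vec[OF one_carrier_mat c(5) v(1)] v by simp
    ultimately show ?thesis
      using mult_add_distrib_mat_vec[OF c(4) v(1) cv(2)] by simp
  qed
  have y: "transpose_mat W *\<^sub>v x = ?H *\<^sub>v x1 + ?H *\<^sub>v (?D *\<^sub>v x2)"
  proof -
    have "?H *\<^sub>v (?D *\<^sub>v x2) = transpose_mat tail *\<^sub>v x2"
      unfolding tail_eq using transpose_mult[OF Delta c(1)] assoc_mult_mat_vec[OF c(2,3) v(2)] by simp
    moreover have "transpose_mat W *\<^sub>v x = ?H *\<^sub>v x1 + transpose_mat tail *\<^sub>v x2"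
    proof (rule eq_vecI)
      fix j assume "j < dim_vec (?H *\<^sub>v x1 + transpose_mat tail *\<^sub>v x2)"
      then have j: "j < k" by (simp add: tail_def)
      have "(transpose_mat W *\<^sub>v x) $ j = (\<Sum>l<n. W $$ (l, j) * x $ l)"
        using W x j by (subst mult_mat_vec_index[of _ k n]) auto
      also have "\<dots> = (?H *\<^sub>v x1 + transpose_mat tail *\<^sub>v x2) $ j"
        unfolding sum_split_at_k using j
        by (simp add: scalar_prod_def atLeast0LessThan head_def tail_def x1_def x2_def)
      finally show "(transpose_mat W *\<^sub>v x) $ j = (?H *\<^sub>v x1 + transpose_mat tail *\<^sub>v x2) $ j" .
    qed (use W in \<open>auto simp: tail_def\<close>)
    ultimately show ?thesis by simp
  qed
  then have yc: "transpose_mat W *\<^sub>v x \<in> carrier_vec k"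
    using cv by simp
  have "(W *\<^sub>v (transpose_mat W *\<^sub>v x)) $ i = (head *\<^sub>v (transpose_mat W *\<^sub>v x)) $ i"
    unfolding mult_mat_vec_index[OF c(1) yc i] using mult_mat_vec_index[OF W yc, of i] i k_less
    by (simp add: head_def)
  also have "head *\<^sub>v (transpose_mat W *\<^sub>v x) =
      (head * ?H) *\<^sub>v x1 + (head * ?H) *\<^sub>v (?D *\<^sub>v x2)"
    unfolding y mult_add_distrib_mat_vec[OF c(1) cv(3,4)]
    using assoc_mult_mat_vec[OF c(1,2) v(1)] assoc_mult_mat_vec[OF c(1,2) cv(1)] by simp
  also have "\<dots> $ i = ((head * ?H) *\<^sub>v x1) $ i + ((head * ?H) *\<^sub>v (?D *\<^sub>v x2)) $ i"
    by (rule index_add_vec) (simp only: carrier_vecD[OF cv(7)] i)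
  finally have Wy: "(W *\<^sub>v (transpose_mat W *\<^sub>v x)) $ i =
      ((head * ?H) *\<^sub>v x1) $ i + ((head * ?H) *\<^sub>v (?D *\<^sub>v x2)) $ i" .
  have inv_i: "x $ i = ((head * ?H) *\<^sub>v x1) $ i + ((head * ?H) *\<^sub>v ((?D * \<Delta>) *\<^sub>v x1)) $ i"
  proof -
    have "x $ i = x1 $ i"
      using i by (simp add: x1_def)
    also have "\<dots> = ((head * ?H) *\<^sub>v x1 + (head * ?H) *\<^sub>v ((?D * \<Delta>) *\<^sub>v x1)) $ i"
      unfolding inv ..
    also have "\<dots> = ((head * ?H) *\<^sub>v x1) $ i + ((head * ?H) *\<^sub>v ((?D * \<Delta>) *\<^sub>v x1)) $ i"
      by (rule index_add_vec) (simp only: carrier_vecD[OF cv(6)] i)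
    finally show ?thesis .
  qed
  have "(S * (?D * \<Delta>)) *\<^sub>v x1 = vec k (\<lambda>i. s i * ((head * ?H) *\<^sub>v ((?D * \<Delta>) *\<^sub>v x1)) $ i)"
    unfolding S assoc_mult_mat_vec[OF c(7,5) v(1)] assoc_mult_mat_vec[OF c(6,4) cv(2)]
    by (rule mat_diag_mult_vec[OF cv(6)])
  moreover have "(S * ?D) *\<^sub>v x2 = vec k (\<lambda>i. s i * ((head * ?H) *\<^sub>v (?D *\<^sub>v x2)) $ i)"
    unfolding S assoc_mult_mat_vec[OF c(7,3) v(2)] assoc_mult_mat_vec[OF c(6,4) cv(1)]
    by (rule mat_diag_mult_vec[OF cv(7)])
  ultimately have "((S * (?D * \<Delta>)) *\<^sub>v x1 - (S * ?D) *\<^sub>v x2) $ i =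
      s i * (((head * ?H) *\<^sub>v ((?D * \<Delta>) *\<^sub>v x1)) $ i - ((head * ?H) *\<^sub>v (?D *\<^sub>v x2)) $ i)"
    using i by (simp add: right_diff_distrib)
  also have "\<dots> = s i * (x - W *\<^sub>v (transpose_mat W *\<^sub>v x)) $ i"
    using inv_i Wy i k_less W x by simp
  finally show ?thesis
    unfolding x1_def x2_def ..
qed

text \<open>The top rows are bounded by the norms of the two blocks, combined by Cauchy-Schwarz.  In the
  remaining rows every weight is at most \<open>s k\<close>, and a projection residual is no longer than the
  vector itself; that last fact is the hypothesis \<open>r_le\<close>.\<close>

lemma residual_le:
  assumes x: "x \<in> carrier_vec n"
  defines "S \<equiv> mat_diag k s * minv (1\<^sub>m k + transpose_mat \<Delta> * \<Delta>)"
    and "r \<equiv> x - W *\<^sub>v (transpose_mat W *\<^sub>v x)"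
  assumes r_le: "(\<Sum>i<n. (r $ i)\<^sup>2) \<le> (\<Sum>i<n. (x $ i)\<^sup>2)"
  shows "(\<Sum>i<n. (s i)\<^sup>2 * (r $ i)\<^sup>2) \<le>
    ((mat_norm2 (S * (transpose_mat \<Delta> * \<Delta>)))\<^sup>2 + (mat_norm2 (S * transpose_mat \<Delta>))\<^sup>2 + (s k)\<^sup>2)
      * (\<Sum>i<n. (x $ i)\<^sup>2)"
proof -
  let ?D = "transpose_mat \<Delta>"
  define x1 where "x1 = vec k (\<lambda>i. x $ i)"
  define x2 where "x2 = vec (n - k) (\<lambda>i. x $ (k + i))"
  define a where "a = mat_norm2 (S * (?D * \<Delta>))"
  define b where "b = mat_norm2 (S * ?D)"
  have c: "?D \<in> carrier_mat k (n - k)" "?D * \<Delta> \<in> carrier_mat k k"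
    "mat_diag k s * (head * transpose_mat head) \<in> carrier_mat k k"
    and v: "x1 \<in> carrier_vec k" "x2 \<in> carrier_vec (n - k)"
    using Delta unfolding x1_def x2_def
    by (auto intro!: mult_carrier_mat[of _ k k])
  then have S: "S \<in> carrier_mat k k"
    unfolding S_def minv_gram by simp
  have PR: "S * (?D * \<Delta>) \<in> carrier_mat k k" "S * ?D \<in> carrier_mat k (n - k)"
    using mult_carrier_mat[OF S c(2)] mult_carrier_mat[OF S c(1)] by auto
  let ?d = "(S * (?D * \<Delta>)) *\<^sub>v x1 - (S * ?D) *\<^sub>v x2"
  have dims: "(S * (?D * \<Delta>)) *\<^sub>v x1 \<in> carrier_vec k" "(S * ?D) *\<^sub>v x2 \<in> carrier_vec k"
    using PR v by (meson mult_mat_vec_carrier)+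
  have "(\<Sum>i<k. (s i)\<^sup>2 * (r $ i)\<^sup>2) = (\<Sum>i<k. (?d $ i)\<^sup>2)"
    unfolding r_def S_def x1_def x2_def
    by (intro sum.cong refl) (simp add: top_residual[OF x, symmetric] power_mult_distrib)
  also have "\<dots> = (vec_norm2 ?d)\<^sup>2"
    unfolding power2_vec_norm2 by (simp only: carrier_vecD[OF minus_carrier_vec[OF dims]])
  also have "\<dots> \<le> (a * vec_norm2 x1 + b * vec_norm2 x2)\<^sup>2"
  proof (rule power_mono)
    have "vec_norm2 ?d \<le> vec_norm2 ((S * (?D * \<Delta>)) *\<^sub>v x1) + vec_norm2 ((S * ?D) *\<^sub>v x2)"
      by (rule vec_norm2_minus_le[OF dims])
    also have "\<dots> \<le> a * vec_norm2 x1 + b * vec_norm2 x2"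
      unfolding a_def b_def
      by (intro add_mono vec_norm2_mult_mat_vec_le[OF PR(1) v(1)] vec_norm2_mult_mat_vec_le[OF PR(2) v(2)])
    finally show "vec_norm2 ?d \<le> a * vec_norm2 x1 + b * vec_norm2 x2" .
  qed simp
  also have "\<dots> \<le> (a\<^sup>2 + b\<^sup>2) * ((vec_norm2 x1)\<^sup>2 + (vec_norm2 x2)\<^sup>2)"
    using zero_le_power2[of "a * vec_norm2 x2 - b * vec_norm2 x1"]
    by (simp add: power2_eq_square algebra_simps)
  also have "(vec_norm2 x1)\<^sup>2 + (vec_norm2 x2)\<^sup>2 = (\<Sum>i<n. (x $ i)\<^sup>2)"
    unfolding power2_vec_norm2 sum_split_at_k by (simp add: x1_def x2_def)
  finally have top: "(\<Sum>i<k. (s i)\<^sup>2 * (r $ i)\<^sup>2) \<le> (a\<^sup>2 + b\<^sup>2) * (\<Sum>i<n. (x $ i)\<^sup>2)" .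
  have "(\<Sum>i<n - k. (s (k + i))\<^sup>2 * (r $ (k + i))\<^sup>2) \<le> (\<Sum>i<n - k. (s k)\<^sup>2 * (r $ (k + i))\<^sup>2)"
  proof (rule sum_mono)
    fix i assume "i \<in> {..<n - k}"
    then have "s (k + i) \<le> s k" "0 < s (k + i)"
      using s_le[of k "k + i"] s_pos[of "k + i"] by auto
    then show "(s (k + i))\<^sup>2 * (r $ (k + i))\<^sup>2 \<le> (s k)\<^sup>2 * (r $ (k + i))\<^sup>2"
      by (intro mult_right_mono power_mono) auto
  qed
  also have "\<dots> = (s k)\<^sup>2 * (\<Sum>i<n - k. (r $ (k + i))\<^sup>2)"
    by (rule sum_distrib_left[symmetric])
  also have "\<dots> \<le> (s k)\<^sup>2 * (\<Sum>i<n. (r $ i)\<^sup>2)"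
    unfolding sum_split_at_k by (intro mult_left_mono) (auto simp: sum_nonneg)
  also have "\<dots> \<le> (s k)\<^sup>2 * (\<Sum>i<n. (x $ i)\<^sup>2)"
    using r_le by (intro mult_left_mono) auto
  finally show ?thesis
    using top unfolding sum_split_at_k[of "\<lambda>i. (s i)\<^sup>2 * (r $ i)\<^sup>2"] a_def b_def by (simp add: distrib_right)
qed

text \<open>Weyl's inequality for \<open>A = A W W\<^sup>T + A (I - W W\<^sup>T)\<close>.  Some nonzero \<open>x\<close> supported on the
  coordinates \<open>0, \<dots>, j\<close> is orthogonal to the Ritz vectors below \<open>j\<close>.  Relative to the length of
  \<open>x\<close>, the image of \<open>x\<close> under \<open>diag s\<close> has length at least \<open>s j\<close>, that of its projection \<open>W W\<^sup>T x\<close>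
  at most \<open>t j\<close>, and that of the residual is bounded by \<open>residual_le\<close>.\<close>

theorem ritz_near:
  assumes j: "j < k"
  defines "S \<equiv> mat_diag k s * minv (1\<^sub>m k + transpose_mat \<Delta> * \<Delta>)"
  shows "s j - t j \<le> sqrt ((mat_norm2 (S * (transpose_mat \<Delta> * \<Delta>)))\<^sup>2
    + (mat_norm2 (S * transpose_mat \<Delta>))\<^sup>2 + (s k)\<^sup>2)" (is "_ \<le> sqrt ?g")
proof -
  obtain x where x: "x \<in> carrier_vec n" "x \<noteq> 0\<^sub>v n"
    and ann: "\<And>l. l < n \<Longrightarrow> l \<noteq> j \<Longrightarrow>
      (\<Sum>i<n. (if l < j then col W l else unit_vec n l) $ i * x $ i) = 0"
    using exists_vec_annihilated[of j n "\<lambda>l. if l < j then col W l else unit_vec n l"] j k_less by auto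
  define y where "y = transpose_mat W *\<^sub>v x"
  define r where "r = x - W *\<^sub>v y"
  have y: "y \<in> carrier_vec k" and Wy: "W *\<^sub>v y \<in> carrier_vec n"
    unfolding y_def using W x by auto
  have x0: "x $ l = 0" if "j < l" "l < n" for l
  proof -
    have "unit_vec n l \<bullet> x = 0"
      using ann[of l] that x(1) by (simp add: scalar_prod_def atLeast0LessThan)
    then show ?thesis
      using that x(1) by simp
  qed
  have y0: "y $ l = 0" if "l < j" for l
    using ann[of l] that j k_less W x(1) unfolding y_def
    by (simp add: scalar_prod_def atLeast0LessThan)
  define X where "X = (\<Sum>i<n. (x $ i)\<^sup>2)"
  have X: "0 < X"
    unfolding X_def by (rule sum_power2_pos[OF x])
  \<comment> \<open>\<open>W y\<close> is the orthogonal projection of \<open>x\<close>, so both it and the residual are no longer than \<open>x\<close>.\<close>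
  have "(\<Sum>i<n. x $ i * (W *\<^sub>v y) $ i) = x \<bullet> (W *\<^sub>v y)"
    using W by (simp add: scalar_prod_def atLeast0LessThan)
  also have "\<dots> = y \<bullet> y"
    unfolding y_def by (rule transpose_vec_mult_scalar[OF W y[unfolded y_def] x(1), symmetric])
  finally have cross: "(\<Sum>i<n. x $ i * (W *\<^sub>v y) $ i) = (\<Sum>l<k. (y $ l)\<^sup>2)"
    using y by (simp add: scalar_prod_def atLeast0LessThan power2_eq_square)
  have "(\<Sum>i<n. (r $ i)\<^sup>2) = (\<Sum>i<n. (x $ i)\<^sup>2 - 2 * (x $ i * (W *\<^sub>v y) $ i) + ((W *\<^sub>v y) $ i)\<^sup>2)"
    unfolding r_def using x(1) carrier_vecD[OF Wy]
    by (intro sum.cong refl, subst index_minus_vec) (auto simp: power2_diff algebra_simps)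
  also have "\<dots> = X - (\<Sum>l<k. (y $ l)\<^sup>2)"
    unfolding sum.distrib sum_subtractf sum_distrib_left[symmetric] cross sum_power2_W[OF y] X_def by simp
  finally have r: "(\<Sum>i<n. (r $ i)\<^sup>2) = X - (\<Sum>l<k. (y $ l)\<^sup>2)" .
  then have r_le: "(\<Sum>i<n. (r $ i)\<^sup>2) \<le> X" and y_le: "(\<Sum>l<k. (y $ l)\<^sup>2) \<le> X"
    using sum_nonneg[of "{..<k}" "\<lambda>l. (y $ l)\<^sup>2"] sum_nonneg[of "{..<n}" "\<lambda>i. (r $ i)\<^sup>2"] by auto
  have "L2_set (\<lambda>i. s i * x $ i) {..<n} = L2_set (\<lambda>i. s i * (W *\<^sub>v y) $ i + s i * r $ i) {..<n}"
    unfolding r_def using x(1) carrier_vecD[OF Wy]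
    by (intro L2_set_cong refl, subst index_minus_vec) (auto simp: algebra_simps)
  also have "\<dots> \<le> L2_set (\<lambda>i. s i * (W *\<^sub>v y) $ i) {..<n} + L2_set (\<lambda>i. s i * r $ i) {..<n}"
    by (rule L2_set_triangle_ineq)
  also have "L2_set (\<lambda>i. s i * (W *\<^sub>v y) $ i) {..<n} \<le> t j * sqrt X"
  proof -
    have "(\<Sum>i<n. (s i * (W *\<^sub>v y) $ i)\<^sup>2) = (\<Sum>l<k. (t l)\<^sup>2 * (y $ l)\<^sup>2)"
      unfolding power_mult_distrib by (rule sum_energy_W[OF y])
    also have "\<dots> \<le> (\<Sum>l<k. (t j)\<^sup>2 * (y $ l)\<^sup>2)"
    proof (rule sum_mono)
      fix l assume l: "l \<in> {..<k}"
      show "(t l)\<^sup>2 * (y $ l)\<^sup>2 \<le> (t j)\<^sup>2 * (y $ l)\<^sup>2"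
        using y0[of l] l t_le[of j l] t_nonneg[of l]
        by (cases "j \<le> l") (auto intro!: mult_right_mono power_mono)
    qed
    also have "\<dots> \<le> (t j)\<^sup>2 * X"
      unfolding sum_distrib_left[symmetric] by (rule mult_left_mono[OF y_le]) simp
    finally have "L2_set (\<lambda>i. s i * (W *\<^sub>v y) $ i) {..<n} \<le> sqrt ((t j)\<^sup>2 * X)"
      unfolding L2_set_def by simp
    then show ?thesis
      using t_nonneg[OF j] by (simp add: real_sqrt_mult)
  qed
  also have "L2_set (\<lambda>i. s i * r $ i) {..<n} \<le> sqrt ?g * sqrt X"
    using residual_le[OF x(1)] r_le
    unfolding L2_set_def power_mult_distrib real_sqrt_mult[symmetric] X_def r_def y_def S_def by simp
  finally have "L2_set (\<lambda>i. s i * x $ i) {..<n} \<le> (t j + sqrt ?g) * sqrt X"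
    by (simp add: distrib_right)
  moreover have "s j * sqrt X \<le> L2_set (\<lambda>i. s i * x $ i) {..<n}"
  proof -
    have "(s j)\<^sup>2 * X = (\<Sum>i<n. (s j)\<^sup>2 * (x $ i)\<^sup>2)"
      unfolding X_def by (rule sum_distrib_left)
    also have "\<dots> \<le> (\<Sum>i<n. (s i * x $ i)\<^sup>2)"
    proof (rule sum_mono)
      fix l assume l: "l \<in> {..<n}"
      show "(s j)\<^sup>2 * (x $ l)\<^sup>2 \<le> (s l * x $ l)\<^sup>2"
        unfolding power_mult_distrib using x0[of l] l s_le[of l j] s_pos[of j] j k_less
        by (cases "l \<le> j") (auto intro!: mult_right_mono power_mono)
    qed
    finally have "sqrt ((s j)\<^sup>2 * X) \<le> L2_set (\<lambda>i. s i * x $ i) {..<n}"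
      unfolding L2_set_def by simp
    then show ?thesis
      using s_pos[of j] j k_less by (simp add: real_sqrt_mult)
  qed
  ultimately have "s j * sqrt X \<le> (t j + sqrt ?g) * sqrt X"
    by linarith
  then show ?thesis
    using X by simp
qed

end

text \<open>Every Krylov vector is \<open>D T a\<close>, where \<open>a\<close> lists the coefficients of its polynomial.  Its first
  \<open>k\<close> coordinates \<open>D\<^sub>1 T\<^sub>1 a\<close> determine \<open>a\<close>, because \<open>D\<^sub>1\<close> is nonsingular and \<open>T\<^sub>1\<close> is a
  Vandermonde matrix with distinct nodes, and so \<open>\<Delta>\<close> computes the other coordinates from them.\<close>

lemma tail_eq_Delta_head:
  defines "D1 \<equiv> mat_diag k c" and "D2 \<equiv> mat_diag (n - k) (\<lambda>i. c (k + i))"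
    and "T1 \<equiv> mat k k (\<lambda>(i, j). s i ^ (2 * j))" and "T2 \<equiv> mat (n - k) k (\<lambda>(i, j). s (k + i) ^ (2 * j))"
  shows "tail = D2 * T2 * minv T1 * minv D1 * head"
    and "D2 * T2 * minv T1 * minv D1 \<in> carrier_mat (n - k) k"
proof -
  have kpos: "0 < k"
    using krylov[of "0\<^sub>v k"] by auto
  have c: "D1 \<in> carrier_mat k k" "D2 \<in> carrier_mat (n - k) (n - k)" "T1 \<in> carrier_mat k k"
    "T2 \<in> carrier_mat (n - k) k"
    unfolding D1_def D2_def T1_def T2_def by auto
  have D1: "minv D1 * D1 = 1\<^sub>m k" "minv D1 \<in> carrier_mat k k"
  proof -
    have "v = 0\<^sub>v k" if v: "v \<in> carrier_vec k" and D: "D1 *\<^sub>v v = 0\<^sub>v k" for v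
    proof (rule eq_vecI)
      fix i assume "i < dim_vec (0\<^sub>v k :: real vec)"
      then have i: "i < k" by simp
      have "c i * v $ i = (D1 *\<^sub>v v) $ i"
        unfolding D1_def mat_diag_mult_vec[OF v] using i by simp
      then show "v $ i = 0\<^sub>v k $ i"
        unfolding D using i c_nonzero[of i] k_less by simp
    qed (use v in simp)
    then show "minv D1 * D1 = 1\<^sub>m k" "minv D1 \<in> carrier_mat k k"
      using minv_mult_self[OF c(1)] by auto
  qed
  have T1: "minv T1 * T1 = 1\<^sub>m k" "minv T1 \<in> carrier_mat k k"
  proof -
    have "v = 0\<^sub>v k" if v: "v \<in> carrier_vec k" and T: "T1 *\<^sub>v v = 0\<^sub>v k" for v
    proof -
      define p where "p = (\<Sum>l<k. monom (v $ l) l)"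
      have coeff: "coeff p l = (if l < k then v $ l else 0)" for l
        unfolding p_def coeff_sum by (simp add: sum.delta' if_distrib cong: if_cong)
      have "p = 0"
      proof (rule poly_eq_0_if_many_roots)
        show "poly p x = 0" if x: "x \<in> (\<lambda>i. (s i)\<^sup>2) ` {..<k}" for x
        proof -
          obtain i where i: "i < k" "x = (s i)\<^sup>2"
            using x by auto
          have "poly p x = (T1 *\<^sub>v v) $ i"
            unfolding mult_mat_vec_index[OF c(3) v i(1)] p_def poly_sum poly_monom i(2) using i(1)
            by (intro sum.cong) (auto simp: T1_def power_mult mult.commute[of "v $ _"])
          then show ?thesis
            unfolding T using i by simp
        qed
        have "degree p \<le> k - 1"
          by (rule degree_le) (auto simp: coeff)
        moreover have "card ((\<lambda>i. (s i)\<^sup>2) ` {..<k}) = k"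
          using card_image[OF inj_on_power2_s[of "{..<k}"]] k_less by simp
        ultimately show "degree p < card ((\<lambda>i. (s i)\<^sup>2) ` {..<k})"
          using kpos by simp
      qed auto
      then show "v = 0\<^sub>v k"
        using v coeff[unfolded \<open>p = 0\<close>] by (intro eq_vecI) (simp_all, metis coeff_0)
    qed
    then show "minv T1 * T1 = 1\<^sub>m k" "minv T1 \<in> carrier_mat k k"
      using minv_mult_self[OF c(3)] by auto
  qed
  have "\<exists>p. degree p < k \<and> (\<forall>i<n. W $$ (i, j) = c i * poly p ((s i)\<^sup>2))" if "j < k" for j
    using krylov[of "unit_vec k j"] W that by auto
  then obtain P where P: "\<And>j. j < k \<Longrightarrow> degree (P j) < k"
    "\<And>j i. j < k \<Longrightarrow> i < n \<Longrightarrow> W $$ (i, j) = c i * poly (P j) ((s i)\<^sup>2)"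
    by metis
  \<comment> \<open>The columns of \<open>C\<close> are the coefficient vectors of the Ritz vectors.\<close>
  define C where "C = mat k k (\<lambda>(l, j). coeff (P j) l)"
  have C: "C \<in> carrier_mat k k"
    unfolding C_def by simp
  have poly_P: "poly (P j) x = (\<Sum>l<k. x ^ l * coeff (P j) l)" if "j < k" for j x
    unfolding poly_altdef using P(1)[OF that] by (intro sum.mono_neutral_cong_left) (auto simp: coeff_eq_0)
  have head_eq: "head = D1 * (T1 * C)"
    unfolding D1_def mat_diag_mult_left[OF mult_carrier_mat[OF c(3) C]] head_def
    using k_less P(2) by (intro eq_matI)
      (auto simp: poly_P T1_def C_def scalar_prod_def atLeast0LessThan power_mult)
  have tail_eq: "tail = D2 * (T2 * C)"
    unfolding D2_def mat_diag_mult_left[OF mult_carrier_mat[OF c(4) C]] tail_def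
    using k_less P(2) by (intro eq_matI)
      (auto simp: poly_P T2_def C_def scalar_prod_def atLeast0LessThan power_mult)
  have TC: "T1 * C \<in> carrier_mat k k"
    using mult_carrier_mat[OF c(3) C] .
  have DT: "D2 * T2 \<in> carrier_mat (n - k) k" "D2 * T2 * minv T1 \<in> carrier_mat (n - k) k"
    using mult_carrier_mat[OF c(2,4)] mult_carrier_mat[OF mult_carrier_mat[OF c(2,4)] T1(2)] by auto
  show "D2 * T2 * minv T1 * minv D1 \<in> carrier_mat (n - k) k"
    using mult_carrier_mat[OF DT(2) D1(2)] .
  have "D2 * T2 * minv T1 * minv D1 * head = D2 * T2 * minv T1 * ((minv D1 * D1) * (T1 * C))"
    unfolding head_eq assoc_mult_mat[OF DT(2) D1(2) mult_carrier_mat[OF c(1) TC]]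
      assoc_mult_mat[OF D1(2) c(1) TC] ..
  also have "\<dots> = D2 * T2 * ((minv T1 * T1) * C)"
    unfolding D1(1) left_mult_one_mat[OF TC] assoc_mult_mat[OF DT(1) T1(2) TC]
      assoc_mult_mat[OF T1(2) c(3) C] ..
  also have "\<dots> = D2 * T2 * C"
    unfolding T1(1) left_mult_one_mat[OF C] ..
  also have "\<dots> = tail"
    unfolding tail_eq by (rule assoc_mult_mat[OF c(2,4) C])
  finally show "tail = D2 * T2 * minv T1 * minv D1 * head" ..
qed

end

section \<open>Ritz values for geometrically decaying singular values\<close>

context ritz_system
begin

text \<open>Geometrically decaying singular values with squared ratio at most \<open>1/5\<close>.  The decay of \<open>c\<close> holds
  as soon as the coefficients of \<open>b\<close> do not increase.\<close>

context
  fixes a r :: real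
  assumes a: "0 < a" and r: "0 < r" "r\<^sup>2 \<le> 1/5"
    and s_geometric: "\<And>i. i < n \<Longrightarrow> s i = a * r ^ i"
    and c_decay: "\<And>i j. j \<le> i \<Longrightarrow> i < n \<Longrightarrow> \<bar>c i\<bar> \<le> r ^ (i - j) * \<bar>c j\<bar>"
begin

text \<open>Interpolating the polynomial of a Krylov vector at the first \<open>k\<close> nodes expresses a later
  coordinate through the first \<open>k\<close> ones, with weights at most \<open>4/3 r\<^bsup>i-j\<^esup>\<close>.  The factor
  \<open>4/9\<close> is \<open>(4/3)\<^sup>2\<close> times the bound \<open>1/4\<close> on \<open>\<Sum> r\<^bsup>2(k-j)\<^esup>\<close>.\<close>

lemma geometric_tail_entry:
  assumes w: "w \<in> carrier_vec k" and i: "k \<le> i" "i < n"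
  shows "((W *\<^sub>v w) $ i)\<^sup>2 \<le> 4/9 * (r\<^sup>2) ^ (i - k) * (\<Sum>j<k. ((W *\<^sub>v w) $ j)\<^sup>2)"
proof -
  define x where "x i = (W *\<^sub>v w) $ i" for i
  define L where "L j = (\<Prod>l\<in>{..<k} - {j}. ((s i)\<^sup>2 - (s l)\<^sup>2) / ((s j)\<^sup>2 - (s l)\<^sup>2))" for j
  obtain p where p: "degree p < k" "\<And>i. i < n \<Longrightarrow> x i = c i * poly p ((s i)\<^sup>2)"
    using krylov[OF w] unfolding x_def by auto
  have inj: "inj_on (\<lambda>i. (s i)\<^sup>2) {..<k}"
    using k_less by (intro inj_on_power2_s) auto
  have s2: "(s l)\<^sup>2 = a\<^sup>2 * (r\<^sup>2) ^ l" if "l < n" for l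
    using s_geometric[OF that] by (simp add: power_mult_distrib power_mult[symmetric] mult.commute)
  have L: "\<bar>L j\<bar> \<le> 4/3" if "j < k" for j
  proof -
    have "L j = (\<Prod>l\<in>{..<k} - {j}. (a\<^sup>2 * (r\<^sup>2) ^ i - a\<^sup>2 * (r\<^sup>2) ^ l) / (a\<^sup>2 * (r\<^sup>2) ^ j - a\<^sup>2 * (r\<^sup>2) ^ l))"
      unfolding L_def using that i k_less by (intro prod.cong) (auto simp: s2)
    then show ?thesis
      using geometric_lagrange_le[of "r\<^sup>2" "a\<^sup>2" k i j] a r i that by simp
  qed
  have "x i = (\<Sum>j<k. c i * (poly p ((s j)\<^sup>2) * L j))"
    unfolding p(2)[OF i(2)] L_def sum_distrib_left[symmetric]
    using lagrange_interpolation[OF inj p(1), of "(s i)\<^sup>2"] by simp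
  then have "\<bar>x i\<bar> \<le> (\<Sum>j<k. \<bar>c i * (poly p ((s j)\<^sup>2) * L j)\<bar>)"
    by (simp add: sum_abs)
  also have "\<dots> \<le> (\<Sum>j<k. 4/3 * (\<bar>r ^ (i - j)\<bar> * \<bar>x j\<bar>))"
  proof (rule sum_mono)
    fix j assume "j \<in> {..<k}"
    then have j: "j < k" "j < n" "j \<le> i"
      using k_less i by auto
    have "\<bar>c i * (poly p ((s j)\<^sup>2) * L j)\<bar> \<le> (r ^ (i - j) * \<bar>c j\<bar>) * (\<bar>poly p ((s j)\<^sup>2)\<bar> * (4/3))"
      unfolding abs_mult using c_decay[OF j(3) i(2)] L[OF j(1)] r by (intro mult_mono) auto
    then show "\<bar>c i * (poly p ((s j)\<^sup>2) * L j)\<bar> \<le> 4/3 * (\<bar>r ^ (i - j)\<bar> * \<bar>x j\<bar>)"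
      using r unfolding p(2)[OF j(2)] by (simp add: abs_mult mult_ac)
  qed
  also have "\<dots> = 4/3 * (\<Sum>j<k. \<bar>r ^ (i - j)\<bar> * \<bar>x j\<bar>)"
    by (rule sum_distrib_left[symmetric])
  also have "\<dots> \<le> 4/3 * (L2_set (\<lambda>j. r ^ (i - j)) {..<k} * L2_set x {..<k})"
    using L2_set_mult_ineq by (intro mult_left_mono) auto
  finally have "\<bar>x i\<bar>\<^sup>2 \<le> (4/3 * (L2_set (\<lambda>j. r ^ (i - j)) {..<k} * L2_set x {..<k}))\<^sup>2"
    by (intro power_mono) auto
  also have "\<dots> = 16/9 * ((\<Sum>j<k. (r ^ (i - j))\<^sup>2) * (\<Sum>j<k. (x j)\<^sup>2))"
    unfolding power_mult_distrib L2_set_def by (simp add: sum_nonneg power2_eq_square)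
  also have "(\<Sum>j<k. (r ^ (i - j))\<^sup>2) = (r\<^sup>2) ^ (i - k) * (\<Sum>j<k. (r\<^sup>2) ^ (k - j))"
    unfolding sum_distrib_left
  proof (rule sum.cong)
    fix j assume "j \<in> {..<k}"
    then have "i - j = (i - k) + (k - j)"
      using i by simp
    then show "(r ^ (i - j))\<^sup>2 = (r\<^sup>2) ^ (i - k) * (r\<^sup>2) ^ (k - j)"
      by (simp add: power_add power_mult_distrib power_mult[symmetric] mult.commute)
  qed simp
  also have "16/9 * ((r\<^sup>2) ^ (i - k) * (\<Sum>j<k. (r\<^sup>2) ^ (k - j)) * (\<Sum>j<k. (x j)\<^sup>2))
      \<le> 16/9 * ((r\<^sup>2) ^ (i - k) * (1/4) * (\<Sum>j<k. (x j)\<^sup>2))"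
    using sum_power_le_quarter[of "r\<^sup>2" k] r
    by (intro mult_left_mono mult_right_mono) (auto simp: sum_nonneg)
  finally show ?thesis
    unfolding x_def by (simp add: mult_ac)
qed

lemma geometric_tail:
  assumes w: "w \<in> carrier_vec k"
  shows "(\<Sum>i = k..<n. ((W *\<^sub>v w) $ i)\<^sup>2) \<le> 5/9 * (\<Sum>j<k. ((W *\<^sub>v w) $ j)\<^sup>2)"
proof -
  define H where "H = (\<Sum>j<k. ((W *\<^sub>v w) $ j)\<^sup>2)"
  have H: "0 \<le> H"
    unfolding H_def by (simp add: sum_nonneg)
  have "(\<Sum>i = k..<n. ((W *\<^sub>v w) $ i)\<^sup>2) \<le> (\<Sum>i = k..<n. 4/9 * (r\<^sup>2) ^ (i - k) * H)"
    unfolding H_def using geometric_tail_entry[OF w] by (intro sum_mono) auto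
  also have "\<dots> = 4/9 * H * (\<Sum>i = 0..<n - k. (r\<^sup>2) ^ i)"
    unfolding sum_distrib_left using sum.shift_bounds_nat_ivl[of "\<lambda>i. 4/9 * (r\<^sup>2) ^ (i - k) * H" 0 k "n - k"] k_less
    by (simp add: mult_ac)
  also have "\<dots> \<le> 4/9 * H * (5/4)"
    unfolding atLeast0LessThan using sum_power_le_five_quarters[of "r\<^sup>2" "n - k"] r H
    by (intro mult_left_mono) auto
  finally show ?thesis
    unfolding H_def by simp
qed

text \<open>By \<open>geometric_tail\<close> the energy bound loses a factor of at most \<open>14/9\<close>, while passing from \<open>s j\<close>
  to \<open>s (Suc j)\<close> gains a factor of at least 5 in the square.\<close>

theorem geometric_ritz_greater:
  assumes j: "j < k"
  shows "s (Suc j) < t j"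
proof -
  have sj: "0 < (s j)\<^sup>2"
    using s_pos[of j] j k_less by simp
  have arith: "1/5 * x < y" if "x \<le> (1 + 5/9) * y" "0 < x" for x y :: real
    using that by (simp add: field_simps)
  have le: "(s j)\<^sup>2 \<le> (1 + 5/9) * (t j)\<^sup>2"
    by (rule ritz_ge_if_tail_small[OF j geometric_tail])
  have "(s (Suc j))\<^sup>2 = r\<^sup>2 * (s j)\<^sup>2"
    using s_geometric[of j] s_geometric[of "Suc j"] j k_less by (simp add: power_mult_distrib mult_ac)
  also have "\<dots> \<le> 1/5 * (s j)\<^sup>2"
    using r by (intro mult_right_mono) auto
  also have "\<dots> < (t j)\<^sup>2"
    using arith[OF le sj] .
  finally show ?thesis
    using t_nonneg[OF j] by (rule power2_less_imp_less)
qed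

end

end

section \<open>Singular value decompositions\<close>

lemma orthonormal_matD:
  assumes "orthonormal_mat N Q"
  shows "Q \<in> carrier_mat N N" "transpose_mat Q \<in> carrier_mat N N"
    "transpose_mat Q * Q = 1\<^sub>m N" "Q * transpose_mat Q = 1\<^sub>m N"
proof -
  show Q: "Q \<in> carrier_mat N N" "transpose_mat Q \<in> carrier_mat N N" and QQ: "transpose_mat Q * Q = 1\<^sub>m N"
    using assms by (auto simp: orthonormal_mat_def)
  show "Q * transpose_mat Q = 1\<^sub>m N"
    by (rule mat_mult_left_right_inverse[OF Q(2,1) QQ])
qed

context
  fixes M U V :: "real mat" and s :: "nat \<Rightarrow> real" and m n :: nat
  assumes M: "M \<in> carrier_mat m n" and svd: "svd M U s V"
begin

lemma svd_dims:
  "n \<le> m" "U \<in> carrier_mat m m" "transpose_mat U \<in> carrier_mat m m" "transpose_mat U * U = 1\<^sub>m m"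
  "V \<in> carrier_mat n n" "transpose_mat V \<in> carrier_mat n n" "transpose_mat V * V = 1\<^sub>m n"
  "V * transpose_mat V = 1\<^sub>m n"
  using svd M orthonormal_matD[of m U] orthonormal_matD[of n V] unfolding svd_def by auto

lemma svd_nonneg: "i < n \<Longrightarrow> 0 \<le> s (Suc i)"
  using svd M unfolding svd_def by auto

lemma svd_gram:
  "transpose_mat M * M = V * mat_diag n (\<lambda>i. (s (Suc i))\<^sup>2) * transpose_mat V"
  "transpose_mat V * (transpose_mat M * M) * V = mat_diag n (\<lambda>i. (s (Suc i))\<^sup>2)"
proof -
  define S where "S = mat m n (\<lambda>(i, j). if i = j then s (Suc i) else 0)"
  let ?D = "mat_diag n (\<lambda>i. (s (Suc i))\<^sup>2)"
  note d = svd_dims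
  have S: "S \<in> carrier_mat m n" "transpose_mat S \<in> carrier_mat n m" and D: "?D \<in> carrier_mat n n"
    unfolding S_def by auto
  have M_eq: "M = U * (S * transpose_mat V)"
    using svd M assoc_mult_mat[OF d(2) S(1) d(6)] unfolding svd_def S_def by simp
  have SV: "S * transpose_mat V \<in> carrier_mat m n" "V * transpose_mat S \<in> carrier_mat n m"
    using mult_carrier_mat[OF S(1) d(6)] mult_carrier_mat[OF d(5) S(2)] by auto
  have SS: "transpose_mat S * S = ?D"
  proof (rule eq_matI)
    fix i j assume "i < dim_row ?D" "j < dim_col ?D"
    then have ij: "i < n" "j < n"
      by (auto simp: mat_diag_def)
    then have "(transpose_mat S * S) $$ (i, j) = (\<Sum>l<m. S $$ (l, i) * S $$ (l, j))"
      using S by (auto simp: scalar_prod_def atLeast0LessThan)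
    also have "\<dots> = (\<Sum>l<m. if l = i then (if i = j then (s (Suc i))\<^sup>2 else 0) else 0)"
      using ij d(1) by (intro sum.cong) (auto simp: S_def power2_eq_square)
    finally show "(transpose_mat S * S) $$ (i, j) = ?D $$ (i, j)"
      using ij d(1) by (simp add: mat_diag_def)
  qed (auto simp: S_def mat_diag_def)
  have "transpose_mat M = V * transpose_mat S * transpose_mat U"
    unfolding M_eq transpose_mult[OF d(2) SV(1)] transpose_mult[OF S(1) d(6)] by simp
  then have "transpose_mat M * M = V * transpose_mat S * (transpose_mat U * (U * (S * transpose_mat V)))"
    using assoc_mult_mat[OF SV(2) d(3) mult_carrier_mat[OF d(2) SV(1)]] M_eq by simp
  also have "transpose_mat U * (U * (S * transpose_mat V)) = S * transpose_mat V"
    using assoc_mult_mat[OF d(3,2) SV(1)] d(4) left_mult_one_mat[OF SV(1)] by simp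
  also have "V * transpose_mat S * (S * transpose_mat V) = V * ?D * transpose_mat V"
    using assoc_mult_mat[OF d(5) S(2) SV(1)] assoc_mult_mat[OF S(2,1) d(6)] SS
      assoc_mult_mat[OF d(5) D d(6)] by simp
  finally show *: "transpose_mat M * M = V * ?D * transpose_mat V" .
  have "transpose_mat V * (V * ?D * transpose_mat V) * V = transpose_mat V * ((V * ?D) * (transpose_mat V * V))"
    using assoc_mult_mat[OF d(6) mult_carrier_mat[OF mult_carrier_mat[OF d(5) D] d(6)] d(5)]
      assoc_mult_mat[OF mult_carrier_mat[OF d(5) D] d(6) d(5)] by simp
  also have "\<dots> = ?D"
    unfolding d(7) right_mult_one_mat[OF mult_carrier_mat[OF d(5) D]]
    using assoc_mult_mat[OF d(6,5) D] d(7) left_mult_one_mat[OF D] by simp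
  finally show "transpose_mat V * (transpose_mat M * M) * V = ?D"
    unfolding * .
qed

lemma svd_col_mult:
  assumes i: "i < n"
  shows "M *\<^sub>v col V i = s (Suc i) \<cdot>\<^sub>v col U i"
    and "transpose_mat M *\<^sub>v col U i = s (Suc i) \<cdot>\<^sub>v col V i"
proof -
  define S where "S = mat m n (\<lambda>(i, j). if i = j then s (Suc i) else 0)"
  note d = svd_dims
  have S: "S \<in> carrier_mat m n" "transpose_mat S \<in> carrier_mat n m"
    unfolding S_def by auto
  have M_eq: "M = U * (S * transpose_mat V)"
    using svd M assoc_mult_mat[OF d(2) S(1) d(6)] unfolding svd_def S_def by simp
  have SV: "S * transpose_mat V \<in> carrier_mat m n" "V * transpose_mat S \<in> carrier_mat n m"
    using mult_carrier_mat[OF S(1) d(6)] mult_carrier_mat[OF d(5) S(2)] by auto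
  have entries: "col (U * S) i = s (Suc i) \<cdot>\<^sub>v col U i" "col (V * transpose_mat S) i = s (Suc i) \<cdot>\<^sub>v col V i"
  proof -
    show "col (U * S) i = s (Suc i) \<cdot>\<^sub>v col U i"
    proof (rule eq_vecI)
      fix l assume "l < dim_vec (s (Suc i) \<cdot>\<^sub>v col U i)"
      then have l: "l < m" using d by simp
      have "col (U * S) i $ l = (\<Sum>h<m. U $$ (l, h) * S $$ (h, i))"
        using l i d(1) d(2) S by (auto simp: scalar_prod_def atLeast0LessThan)
      also have "\<dots> = (\<Sum>h<m. if h = i then s (Suc i) * U $$ (l, i) else 0)"
        using i d(1) by (intro sum.cong) (auto simp: S_def)
      finally show "col (U * S) i $ l = (s (Suc i) \<cdot>\<^sub>v col U i) $ l"
        using l i d(1) d(2) by simp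
    qed (use d S in simp)
    show "col (V * transpose_mat S) i = s (Suc i) \<cdot>\<^sub>v col V i"
    proof (rule eq_vecI)
      fix l assume "l < dim_vec (s (Suc i) \<cdot>\<^sub>v col V i)"
      then have l: "l < n" using d by simp
      have "col (V * transpose_mat S) i $ l = (\<Sum>h<n. V $$ (l, h) * S $$ (i, h))"
        using l i d(1) d(5) S by (auto simp: scalar_prod_def atLeast0LessThan)
      also have "\<dots> = (\<Sum>h<n. if h = i then s (Suc i) * V $$ (l, i) else 0)"
        using i d(1) by (intro sum.cong) (auto simp: S_def)
      finally show "col (V * transpose_mat S) i $ l = (s (Suc i) \<cdot>\<^sub>v col V i) $ l"
        using l i d(1) d(5) by simp
    qed (use d S in simp)
  qed
  have "M * V = U * S"
    unfolding M_eq using assoc_mult_mat[OF d(2) SV(1) d(5)] assoc_mult_mat[OF S(1) d(6) d(5)] d(7)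
      right_mult_one_mat[OF S(1)] by simp
  then have "col (U * S) i = M *\<^sub>v col V i"
    using col_mult2[OF M d(5) i] by simp
  then show "M *\<^sub>v col V i = s (Suc i) \<cdot>\<^sub>v col U i"
    using entries by simp
  have "transpose_mat M = V * transpose_mat S * transpose_mat U"
    unfolding M_eq transpose_mult[OF d(2) SV(1)] transpose_mult[OF S(1) d(6)] by simp
  then have "transpose_mat M * U = V * transpose_mat S"
    using assoc_mult_mat[OF SV(2) d(3) d(2)] d(4) right_mult_one_mat[OF SV(2)] by simp
  then have "col (V * transpose_mat S) i = transpose_mat M *\<^sub>v col U i"
    using col_mult2[of "transpose_mat M" n m U m i] M d(1,2) i by simp
  then show "transpose_mat M *\<^sub>v col U i = s (Suc i) \<cdot>\<^sub>v col V i"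
    using entries by simp
qed

lemma svd_coordinates:
  assumes i: "i < n"
  shows "x \<in> carrier_vec n \<Longrightarrow> col U i \<bullet> (M *\<^sub>v x) = s (Suc i) * (col V i \<bullet> x)"
    and "y \<in> carrier_vec m \<Longrightarrow> col V i \<bullet> (transpose_mat M *\<^sub>v y) = s (Suc i) * (col U i \<bullet> y)"
proof -
  note d = svd_dims
  have u: "col U i \<in> carrier_vec m" and v: "col V i \<in> carrier_vec n"
    using d i by auto
  show "col U i \<bullet> (M *\<^sub>v x) = s (Suc i) * (col V i \<bullet> x)" if x: "x \<in> carrier_vec n"
    using transpose_vec_mult_scalar[OF M x u] svd_col_mult(2)[OF i] smult_scalar_prod_distrib[OF v x] by simp
  show "col V i \<bullet> (transpose_mat M *\<^sub>v y) = s (Suc i) * (col U i \<bullet> y)" if y: "y \<in> carrier_vec m"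
  proof -
    have "col V i \<bullet> (transpose_mat M *\<^sub>v y) = (transpose_mat M *\<^sub>v y) \<bullet> col V i"
      using M y v by (intro comm_scalar_prod[of _ n]) auto
    also have "\<dots> = y \<bullet> (M *\<^sub>v col V i)"
      by (rule transpose_vec_mult_scalar[OF M v y])
    also have "\<dots> = s (Suc i) * (col U i \<bullet> y)"
      unfolding svd_col_mult(1)[OF i] scalar_prod_smult_distrib[OF y u] comm_scalar_prod[OF y u] ..
    finally show ?thesis .
  qed
qed

end

section \<open>Lanczos bidiagonalization\<close>

text \<open>The process after \<open>N\<close> steps without breakdown; positivity of \<open>la\<close> and \<open>lb\<close> makes the
  normalizations genuine divisions.\<close>

locale lanczos_run =
  fixes A :: "real mat" and b :: "real vec" and m n N :: nat
    and p q :: "nat \<Rightarrow> real vec" and la lb :: "nat \<Rightarrow> real"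
  assumes A: "A \<in> carrier_mat m n" and b: "b \<in> carrier_vec m" "0 < vec_norm2 b"
    and run: "lanczos_bidiag A b N p q la lb"
    and la_pos: "\<And>i. 1 \<le> i \<Longrightarrow> i \<le> N \<Longrightarrow> 0 < la i"
    and lb_pos: "\<And>i. 1 \<le> i \<Longrightarrow> i \<le> N \<Longrightarrow> 0 < lb (Suc i)"
begin

lemma lb_q_zero: "lb 1 \<cdot>\<^sub>v q 0 = 0\<^sub>v n"
  using run A unfolding lanczos_bidiag_def by simp

lemma p_one: "p 1 = (1 / vec_norm2 b) \<cdot>\<^sub>v b"
  using run unfolding lanczos_bidiag_def by simp

lemma q_step:
  assumes "1 \<le> j" "j \<le> N"
  shows "la j = vec_norm2 (transpose_mat A *\<^sub>v p j - lb j \<cdot>\<^sub>v q (j - 1))"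
    and "q j = (1 / la j) \<cdot>\<^sub>v (transpose_mat A *\<^sub>v p j - lb j \<cdot>\<^sub>v q (j - 1))"
  using run assms unfolding lanczos_bidiag_def Let_def by auto

lemma p_step:
  assumes "1 \<le> j" "j \<le> N"
  shows "lb (Suc j) = vec_norm2 (A *\<^sub>v q j - la j \<cdot>\<^sub>v p j)"
    and "p (Suc j) = (1 / lb (Suc j)) \<cdot>\<^sub>v (A *\<^sub>v q j - la j \<cdot>\<^sub>v p j)"
  using run assms unfolding lanczos_bidiag_def Let_def by auto

lemma q_carrier: "j \<le> N \<Longrightarrow> q j \<in> carrier_vec n"
proof (induction j)
  case 0
  have "dim_vec (lb 1 \<cdot>\<^sub>v q 0) = n"
    unfolding lb_q_zero by simp
  then show ?case
    by (intro carrier_vecI) simp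
next
  case (Suc j)
  have "dim_vec (q (Suc j)) = dim_vec (q j)"
    using arg_cong[of _ _ dim_vec, OF q_step(2)[of "Suc j"]] Suc.prems by simp
  then show ?case
    using Suc carrier_vecD[of "q j" n] by (intro carrier_vecI) simp
qed

lemma p_carrier: "j \<le> N \<Longrightarrow> p (Suc j) \<in> carrier_vec m"
proof (induction j)
  case 0
  then show ?case
    using p_one b(1) by simp
next
  case (Suc j)
  have "dim_vec (p (Suc (Suc j))) = dim_vec (p (Suc j))"
    using arg_cong[of _ _ dim_vec, OF p_step(2)[of "Suc j"]] Suc.prems by simp
  then show ?case
    using Suc carrier_vecD[of "p (Suc j)" m] by (intro carrier_vecI) simp
qed

lemma p_carrier': "1 \<le> j \<Longrightarrow> j \<le> Suc N \<Longrightarrow> p j \<in> carrier_vec m"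
  using p_carrier[of "j - 1"] by simp

lemma transpose_A_p:
  assumes "1 \<le> j" "j \<le> N"
  shows "transpose_mat A *\<^sub>v p j = la j \<cdot>\<^sub>v q j + lb j \<cdot>\<^sub>v q (j - 1)"
proof -
  have "la j \<cdot>\<^sub>v q j = transpose_mat A *\<^sub>v p j - lb j \<cdot>\<^sub>v q (j - 1)"
    unfolding q_step(2)[OF assms] smult_smult_assoc using la_pos[OF assms] by simp
  then show ?thesis
    using A carrier_vecD[OF q_carrier[of "j - 1"]] assms by (intro eq_vecI) (auto simp: algebra_simps)
qed

lemma A_q:
  assumes "1 \<le> j" "j \<le> N"
  shows "A *\<^sub>v q j = la j \<cdot>\<^sub>v p j + lb (Suc j) \<cdot>\<^sub>v p (Suc j)"
proof -
  have "lb (Suc j) \<cdot>\<^sub>v p (Suc j) = A *\<^sub>v q j - la j \<cdot>\<^sub>v p j"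
    unfolding p_step(2)[OF assms] smult_smult_assoc using lb_pos[OF assms] by simp
  then show ?thesis
    using A p_carrier'[of j] assms by (intro eq_vecI) auto
qed

lemma norm_q: "1 \<le> j \<Longrightarrow> j \<le> N \<Longrightarrow> q j \<bullet> q j = 1"
proof -
  assume j: "1 \<le> j" "j \<le> N"
  have "vec_norm2 (q j) = 1"
    unfolding q_step(2)[OF j] vec_norm2_smult using q_step(1)[OF j] la_pos[OF j] by simp
  then show ?thesis
    by (simp add: vec_norm2_def)
qed

lemma norm_p: "1 \<le> j \<Longrightarrow> j \<le> Suc N \<Longrightarrow> p j \<bullet> p j = 1"
proof -
  assume j: "1 \<le> j" "j \<le> Suc N"
  have "vec_norm2 (p j) = 1"
  proof (cases "j = 1")
    case True
    then show ?thesis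
      using p_one b(2) by (simp add: vec_norm2_smult)
  next
    case False
    then obtain l where l: "j = Suc l" "1 \<le> l" "l \<le> N"
      using j by (cases j) auto
    show ?thesis
      unfolding l(1) p_step(2)[OF l(2,3)] vec_norm2_smult using p_step(1)[OF l(2,3)] lb_pos[OF l(2,3)] by simp
  qed
  then show ?thesis
    by (simp add: vec_norm2_def)
qed

text \<open>Only the newest vectors need work: \<open>q\<^sub>i \<bullet> A\<^sup>T p\<^sub>j = A q\<^sub>i \<bullet> p\<^sub>j\<close> is evaluated once by the recurrence
  for \<open>A\<^sup>T p\<^sub>j\<close> and once by that for \<open>A q\<^sub>i\<close>, and likewise for \<open>p\<^sub>i \<bullet> A q\<^sub>j\<close>.  The statement runs one
  step ahead in \<open>p\<close>, in the order in which the process produces its vectors.\<close>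

lemma orthogonal:
  "J \<le> N \<Longrightarrow> (\<forall>j i. 1 \<le> i \<longrightarrow> i < j \<longrightarrow> j \<le> J \<longrightarrow> q i \<bullet> q j = 0) \<and>
    (\<forall>j i. 1 \<le> i \<longrightarrow> i < j \<longrightarrow> j \<le> Suc J \<longrightarrow> p i \<bullet> p j = 0)"
proof (induction J)
  case (Suc J)
  then have J: "1 \<le> Suc J" "Suc J \<le> N"
    by auto
  have qJ: "\<And>i j. 1 \<le> i \<Longrightarrow> i < j \<Longrightarrow> j \<le> J \<Longrightarrow> q i \<bullet> q j = 0"
    and pJ: "\<And>i j. 1 \<le> i \<Longrightarrow> i < j \<Longrightarrow> j \<le> Suc J \<Longrightarrow> p i \<bullet> p j = 0"
    using Suc J by auto
  have q_new: "q i \<bullet> q (Suc J) = 0" if i: "1 \<le> i" "i < Suc J" for i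
  proof -
    have c: "q i \<in> carrier_vec n" "q (Suc J) \<in> carrier_vec n" "q J \<in> carrier_vec n"
      "p (Suc J) \<in> carrier_vec m" "p i \<in> carrier_vec m" "p (Suc i) \<in> carrier_vec m"
      using i J by (auto intro: q_carrier p_carrier p_carrier')
    have "(transpose_mat A *\<^sub>v p (Suc J)) \<bullet> q i = la (Suc J) * (q (Suc J) \<bullet> q i) + lb (Suc J) * (q J \<bullet> q i)"
      unfolding transpose_A_p[OF J] using c by (subst add_scalar_prod_distrib[of _ n]) auto
    moreover have "(transpose_mat A *\<^sub>v p (Suc J)) \<bullet> q i = p (Suc J) \<bullet> (A *\<^sub>v q i)"
      by (rule transpose_vec_mult_scalar[OF A c(1) c(4)])
    moreover have "p (Suc J) \<bullet> (A *\<^sub>v q i) = la i * (p i \<bullet> p (Suc J)) + lb (Suc i) * (p (Suc i) \<bullet> p (Suc J))"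
      unfolding A_q[OF i(1) less_imp_le[OF order.strict_trans2[OF i(2) J(2)]]]
      using c comm_scalar_prod[OF c(4) c(5)] comm_scalar_prod[OF c(4) c(6)]
      by (subst scalar_prod_add_distrib[of _ m]) auto
    moreover have "p i \<bullet> p (Suc J) = 0"
      using pJ i by simp
    moreover have "lb (Suc i) * (p (Suc i) \<bullet> p (Suc J)) = lb (Suc J) * (q J \<bullet> q i)"
    proof (cases "i = J")
      case True
      then show ?thesis
        using norm_p[of "Suc J"] norm_q[of J] i J by simp
    next
      case False
      then show ?thesis
        using pJ[of "Suc i" "Suc J"] qJ[of i J] comm_scalar_prod[OF c(3) c(1)] i by simp
    qed
    ultimately have "la (Suc J) * (q (Suc J) \<bullet> q i) = 0"
      by simp
    then show ?thesis
      using la_pos[OF J] comm_scalar_prod[OF c(1,2)] by simp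
  qed
  then have qS: "\<And>i j. 1 \<le> i \<Longrightarrow> i < j \<Longrightarrow> j \<le> Suc J \<Longrightarrow> q i \<bullet> q j = 0"
    using qJ by (metis le_SucE)
  have p_new: "p i \<bullet> p (Suc (Suc J)) = 0" if i: "1 \<le> i" "i < Suc (Suc J)" for i
  proof -
    have c: "q i \<in> carrier_vec n" "q (Suc J) \<in> carrier_vec n" "q (i - 1) \<in> carrier_vec n"
      "p (Suc J) \<in> carrier_vec m" "p i \<in> carrier_vec m" "p (Suc (Suc J)) \<in> carrier_vec m"
      using i J by (auto intro: q_carrier p_carrier p_carrier')
    have iN: "i \<le> N"
      using i J by simp
    have "p i \<bullet> (A *\<^sub>v q (Suc J)) = la (Suc J) * (p i \<bullet> p (Suc J)) + lb (Suc (Suc J)) * (p i \<bullet> p (Suc (Suc J)))"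
      unfolding A_q[OF J] using c by (subst scalar_prod_add_distrib[of _ m]) auto
    moreover have "p i \<bullet> (A *\<^sub>v q (Suc J)) = (transpose_mat A *\<^sub>v p i) \<bullet> q (Suc J)"
      by (rule transpose_vec_mult_scalar[OF A c(2) c(5), symmetric])
    moreover have "(transpose_mat A *\<^sub>v p i) \<bullet> q (Suc J) =
        la i * (q i \<bullet> q (Suc J)) + (lb i \<cdot>\<^sub>v q (i - 1)) \<bullet> q (Suc J)"
      unfolding transpose_A_p[OF i(1) iN] using c by (subst add_scalar_prod_distrib[of _ n]) auto
    moreover have "(lb i \<cdot>\<^sub>v q (i - 1)) \<bullet> q (Suc J) = 0"
    proof (cases "i = 1")
      case True
      then show ?thesis
        using lb_q_zero c(2) by simp
    next
      case False
      then show ?thesis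
        using qS[of "i - 1" "Suc J"] i c by simp
    qed
    moreover have "la i * (q i \<bullet> q (Suc J)) = la (Suc J) * (p i \<bullet> p (Suc J))"
      using norm_p[of "Suc J"] norm_q[of "Suc J"] pJ[of i "Suc J"] qS[of i "Suc J"] i J
      by (cases "i = Suc J") auto
    ultimately have "lb (Suc (Suc J)) * (p i \<bullet> p (Suc (Suc J))) = 0"
      by simp
    then show ?thesis
      using lb_pos[OF J] by simp
  qed
  have "\<And>i j. 1 \<le> i \<Longrightarrow> i < j \<Longrightarrow> j \<le> Suc (Suc J) \<Longrightarrow> p i \<bullet> p j = 0"
    using p_new pJ by (metis le_SucE)
  then show ?case
    using qS by blast
qed simp

lemma q_orthonormal:
  assumes "1 \<le> i" "i \<le> N" "1 \<le> j" "j \<le> N"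
  shows "q i \<bullet> q j = (if i = j then 1 else 0)"
  using orthogonal[of N] norm_q[of i] assms comm_scalar_prod[OF q_carrier q_carrier, of i j]
  by (cases i j rule: linorder_cases) auto

lemma p_orthonormal:
  assumes "1 \<le> i" "i \<le> Suc N" "1 \<le> j" "j \<le> Suc N"
  shows "p i \<bullet> p j = (if i = j then 1 else 0)"
  using orthogonal[of N] norm_p[of i] assms comm_scalar_prod[OF p_carrier' p_carrier', of i j]
  by (cases i j rule: linorder_cases) auto

definition P_mat :: "nat \<Rightarrow> real mat" where "P_mat k = mat_of_cols m (map p [1..<k + 2])"
definition Q_mat :: "nat \<Rightarrow> real mat" where "Q_mat k = mat_of_cols n (map q [1..<k + 1])"

context
  fixes k :: nat
  assumes k: "k \<le> N"
begin

lemma P_carrier: "P_mat k \<in> carrier_mat m (Suc k)" "transpose_mat (P_mat k) \<in> carrier_mat (Suc k) m"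
  and Q_carrier: "Q_mat k \<in> carrier_mat n k" "transpose_mat (Q_mat k) \<in> carrier_mat k n"
  unfolding P_mat_def Q_mat_def using mat_of_cols_carrier(1)[of m "map p [1..<k + 2]"]
    mat_of_cols_carrier(1)[of n "map q [1..<k + 1]"] by auto

lemma col_P: "i < Suc k \<Longrightarrow> col (P_mat k) i = p (Suc i)"
  unfolding P_mat_def using p_carrier[of i] k by (subst col_mat_of_cols) (auto simp del: upt_Suc)

lemma col_Q: "i < k \<Longrightarrow> col (Q_mat k) i = q (Suc i)"
  unfolding Q_mat_def using q_carrier[of "Suc i"] k by (subst col_mat_of_cols) (auto simp del: upt_Suc)

lemma Q_orthonormal: "transpose_mat (Q_mat k) * Q_mat k = 1\<^sub>m k"
  using Q_carrier k by (intro eq_matI) (auto simp: col_Q q_orthonormal)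

lemma P_projection:
  assumes i: "1 \<le> i" "i \<le> Suc k"
  shows "P_mat k *\<^sub>v (transpose_mat (P_mat k) *\<^sub>v p i) = p i"
proof -
  have "transpose_mat (P_mat k) *\<^sub>v p i = unit_vec (Suc k) (i - 1)"
    using P_carrier k i by (intro eq_vecI) (auto simp: col_P p_orthonormal)
  moreover have "P_mat k *\<^sub>v unit_vec (Suc k) (i - 1) = col (P_mat k) (i - 1)"
    using P_carrier i by (intro eq_vecI) auto
  ultimately show ?thesis
    using col_P[of "i - 1"] i by simp
qed

text \<open>The recurrence puts \<open>A q\<^sub>j\<close> into the span of \<open>p\<^sub>j\<close> and \<open>p\<^bsub>j+1\<^esub>\<close>, so compressing \<open>A Q\<^sub>k\<close> with \<open>P\<^bsub>k+1\<^esub>\<close>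
  loses nothing; this is why \<open>B\<^sub>k\<^sup>T B\<^sub>k\<close> is the compression of \<open>A\<^sup>T A\<close>.\<close>

lemma P_projection_A_Q: "P_mat k * (transpose_mat (P_mat k) * (A * Q_mat k)) = A * Q_mat k"
proof -
  let ?P = "P_mat k"
  have c: "A * Q_mat k \<in> carrier_mat m k" "transpose_mat ?P * (A * Q_mat k) \<in> carrier_mat (Suc k) k"
    "?P * (transpose_mat ?P * (A * Q_mat k)) \<in> carrier_mat m k"
    using mult_carrier_mat[OF A Q_carrier(1)] mult_carrier_mat[OF P_carrier(2) mult_carrier_mat[OF A Q_carrier(1)]]
      mult_carrier_mat[OF P_carrier(1) mult_carrier_mat[OF P_carrier(2) mult_carrier_mat[OF A Q_carrier(1)]]]
    by auto
  have proj: "?P *\<^sub>v (transpose_mat ?P *\<^sub>v (A *\<^sub>v q (Suc j))) = A *\<^sub>v q (Suc j)" if j: "j < k" for j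
  proof -
    have pc: "p (Suc j) \<in> carrier_vec m" "p (Suc (Suc j)) \<in> carrier_vec m"
      using j k by (auto intro: p_carrier)
    have tc: "transpose_mat ?P *\<^sub>v p (Suc j) \<in> carrier_vec (Suc k)" "transpose_mat ?P *\<^sub>v p (Suc (Suc j)) \<in> carrier_vec (Suc k)"
      using P_carrier(2) pc by auto
    have sc: "la (Suc j) \<cdot>\<^sub>v p (Suc j) \<in> carrier_vec m" "lb (Suc (Suc j)) \<cdot>\<^sub>v p (Suc (Suc j)) \<in> carrier_vec m"
      "la (Suc j) \<cdot>\<^sub>v (transpose_mat ?P *\<^sub>v p (Suc j)) \<in> carrier_vec (Suc k)"
      "lb (Suc (Suc j)) \<cdot>\<^sub>v (transpose_mat ?P *\<^sub>v p (Suc (Suc j))) \<in> carrier_vec (Suc k)"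
      using pc tc by auto
    have A: "A *\<^sub>v q (Suc j) = la (Suc j) \<cdot>\<^sub>v p (Suc j) + lb (Suc (Suc j)) \<cdot>\<^sub>v p (Suc (Suc j))"
      using j k by (intro A_q) auto
    show ?thesis
      unfolding A mult_add_distrib_mat_vec[OF P_carrier(2) sc(1,2)] mult_mat_vec[OF P_carrier(2) pc(1)]
        mult_mat_vec[OF P_carrier(2) pc(2)] mult_add_distrib_mat_vec[OF P_carrier(1) sc(3,4)]
        mult_mat_vec[OF P_carrier(1) tc(1)] mult_mat_vec[OF P_carrier(1) tc(2)]
      using P_projection[of "Suc j"] P_projection[of "Suc (Suc j)"] j by simp
  qed
  have "col (?P * (transpose_mat ?P * (A * Q_mat k))) j = col (A * Q_mat k) j" if j: "j < k" for j
    using proj[OF j] col_mult2[OF P_carrier(1) c(2) j] col_mult2[OF P_carrier(2) c(1) j]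
      col_mult2[OF A Q_carrier(1) j] col_Q[OF j] by simp
  then show ?thesis
    by (intro mat_col_eqI) (use c in \<open>simp_all only: carrier_matD\<close>)
qed

lemma B_carrier: "lanczos_B A p q k \<in> carrier_mat (Suc k) k"
proof -
  have "lanczos_B A p q k = transpose_mat (P_mat k) * A * Q_mat k"
    unfolding lanczos_B_def P_mat_def Q_mat_def using A by simp
  then show ?thesis
    using mult_carrier_mat[OF mult_carrier_mat[OF P_carrier(2) A] Q_carrier(1)] by simp
qed

lemma B_gram:
  "transpose_mat (lanczos_B A p q k) * lanczos_B A p q k =
    transpose_mat (Q_mat k) * (transpose_mat A * A) * Q_mat k"
proof -
  let ?P = "P_mat k" and ?Q = "Q_mat k"
  have AT: "transpose_mat A \<in> carrier_mat n m"
    using A by simp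
  have AQ: "A * ?Q \<in> carrier_mat m k" "transpose_mat (A * ?Q) \<in> carrier_mat k m"
    using mult_carrier_mat[OF A Q_carrier(1)] by auto
  have PAQ: "transpose_mat ?P * (A * ?Q) \<in> carrier_mat (Suc k) k"
    using mult_carrier_mat[OF P_carrier(2) AQ(1)] .
  have B: "lanczos_B A p q k = transpose_mat ?P * (A * ?Q)"
    unfolding lanczos_B_def P_mat_def[symmetric] Q_mat_def[symmetric] using A
      assoc_mult_mat[OF P_carrier(2) A Q_carrier(1)] unfolding P_mat_def Q_mat_def by simp
  have "transpose_mat (lanczos_B A p q k) * lanczos_B A p q k =
      transpose_mat (A * ?Q) * ?P * (transpose_mat ?P * (A * ?Q))"
    unfolding B transpose_mult[OF P_carrier(2) AQ(1)] by simp
  also have "\<dots> = transpose_mat (A * ?Q) * (A * ?Q)"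
    unfolding assoc_mult_mat[OF AQ(2) P_carrier(1) PAQ] P_projection_A_Q ..
  also have "\<dots> = transpose_mat ?Q * (transpose_mat A * A) * ?Q"
    unfolding transpose_mult[OF A Q_carrier(1)] assoc_mult_mat[OF Q_carrier(2) AT AQ(1)]
      assoc_mult_mat[OF Q_carrier(2) mult_carrier_mat[OF AT A] Q_carrier(1)]
      assoc_mult_mat[OF AT A Q_carrier(1)] ..
  finally show ?thesis .
qed

end

text \<open>Each step of the process multiplies by \<open>A\<close> or \<open>A\<^sup>T\<close> and subtracts earlier vectors, so in singular
  coordinates the vectors are polynomials in \<open>\<sigma>\<^sup>2\<close> times those of \<open>b\<close>, with one more factor \<open>\<sigma>\<close>
  for the \<open>q\<^sub>j\<close>.  The middle
  conjunct is about \<open>lb (Suc J) \<cdot>\<^sub>v q J\<close> instead of \<open>q J\<close> because \<open>q 0\<close> is only known to vanish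
  after scaling.\<close>

lemma krylov_polynomials:
  assumes svd: "svd A U \<sigma> V" and J: "J \<le> N"
  shows "(\<exists>\<phi>. degree \<phi> \<le> J \<and> (\<forall>i<n. col U i \<bullet> p (Suc J) = (col U i \<bullet> b) * poly \<phi> ((\<sigma> (Suc i))\<^sup>2)))
    \<and> (\<exists>\<pi>. degree \<pi> \<le> J \<and> (\<forall>i<n. col V i \<bullet> (lb (Suc J) \<cdot>\<^sub>v q J) =
          \<sigma> (Suc i) * (col U i \<bullet> b) * poly \<pi> ((\<sigma> (Suc i))\<^sup>2)))
    \<and> (1 \<le> J \<longrightarrow> (\<exists>\<pi>. degree \<pi> < J \<and> (\<forall>i<n. col V i \<bullet> q J =
          \<sigma> (Suc i) * (col U i \<bullet> b) * poly \<pi> ((\<sigma> (Suc i))\<^sup>2))))"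
  using J
proof (induction J)
  case 0
  note d = svd_dims[OF A svd]
  have "col U i \<bullet> p (Suc 0) = (col U i \<bullet> b) * poly [:1 / vec_norm2 b:] ((\<sigma> (Suc i))\<^sup>2)" if "i < n" for i
    using p_one d that b(1) by simp
  moreover have "col V i \<bullet> (lb (Suc 0) \<cdot>\<^sub>v q 0) = \<sigma> (Suc i) * (col U i \<bullet> b) * poly 0 ((\<sigma> (Suc i))\<^sup>2)" if "i < n" for i
    using lb_q_zero d that by simp
  ultimately show ?case
    by (intro conjI exI[of _ "[:1 / vec_norm2 b:]"] exI[of _ 0]) auto
next
  case (Suc J)
  note d = svd_dims[OF A svd]
  have J: "1 \<le> Suc J" "Suc J \<le> N"
    using Suc by auto
  obtain \<phi> \<pi> where deg: "degree \<phi> \<le> J" "degree \<pi> \<le> J"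
    and \<phi>: "\<And>i. i < n \<Longrightarrow> col U i \<bullet> p (Suc J) = (col U i \<bullet> b) * poly \<phi> ((\<sigma> (Suc i))\<^sup>2)"
    and \<pi>: "\<And>i. i < n \<Longrightarrow> col V i \<bullet> (lb (Suc J) \<cdot>\<^sub>v q J) = \<sigma> (Suc i) * (col U i \<bullet> b) * poly \<pi> ((\<sigma> (Suc i))\<^sup>2)"
    using Suc by auto
  have c: "q (Suc J) \<in> carrier_vec n" "q J \<in> carrier_vec n" "p (Suc J) \<in> carrier_vec m"
    "p (Suc (Suc J)) \<in> carrier_vec m"
    using J by (auto intro: q_carrier p_carrier)
  have la: "la (Suc J) \<noteq> 0" and lb: "lb (Suc (Suc J)) \<noteq> 0"
    using la_pos[OF J] lb_pos[OF J] by auto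
  define \<pi>' where "\<pi>' = smult (1 / la (Suc J)) (\<phi> - \<pi>)"
  have deg': "degree \<pi>' \<le> J"
    unfolding \<pi>'_def using deg by (intro order_trans[OF degree_smult_le] degree_diff_le) auto
  have \<pi>': "col V i \<bullet> q (Suc J) = \<sigma> (Suc i) * (col U i \<bullet> b) * poly \<pi>' ((\<sigma> (Suc i))\<^sup>2)" if i: "i < n" for i
  proof -
    have v: "col V i \<in> carrier_vec n"
      using d i by simp
    have "\<sigma> (Suc i) * (col U i \<bullet> p (Suc J)) = col V i \<bullet> (transpose_mat A *\<^sub>v p (Suc J))"
      using svd_coordinates(2)[OF A svd i c(3)] by simp
    also have "\<dots> = la (Suc J) * (col V i \<bullet> q (Suc J)) + col V i \<bullet> (lb (Suc J) \<cdot>\<^sub>v q J)"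
      unfolding transpose_A_p[OF J] using c v by (subst scalar_prod_add_distrib[of _ n]) auto
    finally have "la (Suc J) * (col V i \<bullet> q (Suc J)) = \<sigma> (Suc i) * (col U i \<bullet> b) * poly (\<phi> - \<pi>) ((\<sigma> (Suc i))\<^sup>2)"
      unfolding \<phi>[OF i] \<pi>[OF i] by (simp add: algebra_simps)
    then show ?thesis
      unfolding \<pi>'_def using la by (simp add: field_simps)
  qed
  define \<phi>' where "\<phi>' = smult (1 / lb (Suc (Suc J))) (pCons 0 \<pi>' - smult (la (Suc J)) \<phi>)"
  have "degree \<phi>' \<le> Suc J"
    unfolding \<phi>'_def using deg deg'
    by (intro order_trans[OF degree_smult_le] degree_diff_le order_trans[OF degree_pCons_le]) auto
  moreover have "col U i \<bullet> p (Suc (Suc J)) = (col U i \<bullet> b) * poly \<phi>' ((\<sigma> (Suc i))\<^sup>2)" if i: "i < n" for i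
  proof -
    have u: "col U i \<in> carrier_vec m"
      using d(1,2) i by (intro col_carrier_vec[of i m]) auto
    have "\<sigma> (Suc i) * (col V i \<bullet> q (Suc J)) = col U i \<bullet> (A *\<^sub>v q (Suc J))"
      using svd_coordinates(1)[OF A svd i c(1)] by simp
    also have "\<dots> = la (Suc J) * (col U i \<bullet> p (Suc J)) + lb (Suc (Suc J)) * (col U i \<bullet> p (Suc (Suc J)))"
      unfolding A_q[OF J] using c u by (subst scalar_prod_add_distrib[of _ m]) auto
    finally have "lb (Suc (Suc J)) * (col U i \<bullet> p (Suc (Suc J))) =
        (col U i \<bullet> b) * poly (pCons 0 \<pi>' - smult (la (Suc J)) \<phi>) ((\<sigma> (Suc i))\<^sup>2)"
      unfolding \<phi>[OF i] \<pi>'[OF i] by (simp add: algebra_simps power2_eq_square)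
    then show ?thesis
      unfolding \<phi>'_def using lb by (simp add: field_simps)
  qed
  moreover have "col V i \<bullet> (lb (Suc (Suc J)) \<cdot>\<^sub>v q (Suc J)) =
      \<sigma> (Suc i) * (col U i \<bullet> b) * poly (smult (lb (Suc (Suc J))) \<pi>') ((\<sigma> (Suc i))\<^sup>2)" if i: "i < n" for i
    using \<pi>'[OF i] d i c by simp
  moreover have "degree (smult (lb (Suc (Suc J))) \<pi>') \<le> Suc J" "degree \<pi>' < Suc J"
    using deg' order_trans[OF degree_smult_le] by auto
  ultimately show ?case
    using \<pi>' by blast
qed

end

context lanczos_run
begin

text \<open>The Ritz vectors are \<open>Q\<^sub>k v\<close> for the right singular vectors \<open>v\<close> of \<open>B\<^sub>k\<close>; multiplying by the transpose
  of \<open>V\<close> passes to the coordinates of the right singular vectors of \<open>A\<close>.\<close>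

theorem ritz_system_lanczos:
  assumes svd: "svd A U \<sigma> V" and svd_B: "svd (lanczos_B A p q k) U' \<theta> V'"
    and k: "0 < k" "k \<le> N" "k < n"
    and coeff: "\<And>i. i < n \<Longrightarrow> col U i \<bullet> b \<noteq> 0"
    and \<sigma>_pos: "\<And>i. i < n \<Longrightarrow> 0 < \<sigma> (Suc i)"
    and \<sigma>_decreasing: "\<And>i j. i < j \<Longrightarrow> j < n \<Longrightarrow> \<sigma> (Suc j) < \<sigma> (Suc i)"
    and \<theta>_decreasing: "\<And>i j. i < j \<Longrightarrow> j < k \<Longrightarrow> \<theta> (Suc j) < \<theta> (Suc i)"
  shows "ritz_system n k (\<lambda>i. \<sigma> (Suc i)) (\<lambda>j. \<theta> (Suc j)) (\<lambda>i. \<sigma> (Suc i) * (col U i \<bullet> b))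
    (transpose_mat V * (Q_mat k * V'))"
proof
  note d = svd_dims[OF A svd] and d' = svd_dims[OF B_carrier[OF k(2)] svd_B]
  let ?Q = "Q_mat k" and ?W = "transpose_mat V * (Q_mat k * V')"
    and ?S = "mat_diag n (\<lambda>i. (\<sigma> (Suc i))\<^sup>2)"
  note Q = Q_carrier[OF k(2)]
  have S: "?S \<in> carrier_mat n n"
    by simp
  have QV: "?Q * V' \<in> carrier_mat n k" "transpose_mat (?Q * V') \<in> carrier_mat k n"
    using mult_carrier_mat[OF Q(1) d'(5)] by auto
  show W: "?W \<in> carrier_mat n k"
    using mult_carrier_mat[OF d(6) QV(1)] .
  have WT: "transpose_mat ?W = transpose_mat (?Q * V') * V"
    using transpose_mult[OF d(6) QV(1)] by simp
  have VW: "V * ?W = ?Q * V'"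
    using assoc_mult_mat[OF d(5,6) QV(1)] d(8) left_mult_one_mat[OF QV(1)] by simp
  have QV_T: "transpose_mat (?Q * V') = transpose_mat V' * transpose_mat ?Q"
    by (rule transpose_mult[OF Q(1) d'(5)])
  have "transpose_mat ?W * ?W = transpose_mat (?Q * V') * (?Q * V')"
    unfolding WT assoc_mult_mat[OF QV(2) d(5) W] VW ..
  also have "\<dots> = transpose_mat V' * ((transpose_mat ?Q * ?Q) * V')"
    unfolding QV_T assoc_mult_mat[OF d'(6) Q(2) QV(1)] assoc_mult_mat[OF Q(2) Q(1) d'(5)] ..
  also have "\<dots> = 1\<^sub>m k"
    unfolding Q_orthonormal[OF k(2)] left_mult_one_mat[OF d'(5)] d'(7) ..
  finally show "transpose_mat ?W * ?W = 1\<^sub>m k" .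
  have VS: "V * ?S \<in> carrier_mat n n" "V * ?S * transpose_mat V \<in> carrier_mat n n"
    using mult_carrier_mat[OF d(5) S] mult_carrier_mat[OF mult_carrier_mat[OF d(5) S] d(6)] by auto
  have "transpose_mat ?W * ?S * ?W = transpose_mat (?Q * V') * ((V * ?S * transpose_mat V) * (?Q * V'))"
    unfolding WT assoc_mult_mat[OF QV(2) d(5) S] assoc_mult_mat[OF QV(2) VS(1) W]
      assoc_mult_mat[OF VS(1) d(6) QV(1)] ..
  also have "\<dots> = transpose_mat V' * (transpose_mat ?Q * (transpose_mat A * A) * ?Q) * V'"
  proof -
    have G: "transpose_mat A * A \<in> carrier_mat n n"
      using mult_carrier_mat[of "transpose_mat A" n m A n] A by simp
    have GQ: "transpose_mat ?Q * (transpose_mat A * A) \<in> carrier_mat k n"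
      using mult_carrier_mat[OF Q(2) G] .
    show ?thesis
      unfolding QV_T svd_gram(1)[OF A svd, symmetric]
        assoc_mult_mat[OF d'(6) Q(2) mult_carrier_mat[OF G QV(1)]]
        assoc_mult_mat[OF d'(6) mult_carrier_mat[OF GQ Q(1)] d'(5)]
        assoc_mult_mat[OF GQ Q(1) d'(5)] assoc_mult_mat[OF Q(2) G QV(1)] ..
  qed
  also have "\<dots> = mat_diag k (\<lambda>j. (\<theta> (Suc j))\<^sup>2)"
    unfolding B_gram[OF k(2), symmetric] by (rule svd_gram(2)[OF B_carrier[OF k(2)] svd_B])
  finally show "transpose_mat ?W * ?S * ?W = mat_diag k (\<lambda>j. (\<theta> (Suc j))\<^sup>2)" .
  show "0 \<le> \<theta> (Suc j)" if "j < k" for j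
    using svd_nonneg[OF B_carrier[OF k(2)] svd_B that] .
  show "\<exists>p. degree p < k \<and> (\<forall>i<n. (?W *\<^sub>v w) $ i = \<sigma> (Suc i) * (col U i \<bullet> b) * poly p ((\<sigma> (Suc i))\<^sup>2))"
    if w: "w \<in> carrier_vec k" for w
  proof -
    define y where "y = V' *\<^sub>v w"
    have y: "y \<in> carrier_vec k"
      unfolding y_def using d'(5) w by (rule mult_mat_vec_carrier)
    have Ww: "?W *\<^sub>v w = transpose_mat V *\<^sub>v (?Q *\<^sub>v y)"
      unfolding y_def assoc_mult_mat_vec[OF d(6) QV(1) w] assoc_mult_mat_vec[OF Q(1) d'(5) w] ..
    have "\<exists>\<pi>. degree \<pi> < Suc j \<and> (\<forall>i<n. col V i \<bullet> q (Suc j) =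
        \<sigma> (Suc i) * (col U i \<bullet> b) * poly \<pi> ((\<sigma> (Suc i))\<^sup>2))" if "j < k" for j
      using krylov_polynomials[OF svd, of "Suc j"] that k by simp
    then obtain \<pi> where deg: "\<And>j. j < k \<Longrightarrow> degree (\<pi> j) < Suc j"
      and \<pi>: "\<And>j i. j < k \<Longrightarrow> i < n \<Longrightarrow> col V i \<bullet> q (Suc j) =
        \<sigma> (Suc i) * (col U i \<bullet> b) * poly (\<pi> j) ((\<sigma> (Suc i))\<^sup>2)"
      by metis
    define P where "P = (\<Sum>j<k. smult (y $ j) (\<pi> j))"
    have "degree P \<le> k - 1"
      unfolding P_def
    proof (rule degree_sum_le)
      fix j assume "j \<in> {..<k}"
      then show "degree (smult (y $ j) (\<pi> j)) \<le> k - 1"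
        using deg[of j] degree_smult_le[of "y $ j" "\<pi> j"] by simp
    qed simp
    moreover have "(?W *\<^sub>v w) $ i = \<sigma> (Suc i) * (col U i \<bullet> b) * poly P ((\<sigma> (Suc i))\<^sup>2)" if i: "i < n" for i
    proof -
      have v: "col V i \<in> carrier_vec n"
        using d(5) i by simp
      have entry: "(transpose_mat ?Q *\<^sub>v col V i) $ j = col V i \<bullet> q (Suc j)" if j: "j < k" for j
        using Q j comm_scalar_prod[OF q_carrier v, of "Suc j"] k by (simp add: col_Q[OF k(2)])
      have "(?W *\<^sub>v w) $ i = col V i \<bullet> (?Q *\<^sub>v y)"
        unfolding Ww using d(5) i by simp
      also have "\<dots> = (transpose_mat ?Q *\<^sub>v col V i) \<bullet> y"
        by (rule transpose_vec_mult_scalar[OF Q(1) y v, symmetric])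
      also have "\<dots> = (\<Sum>j<k. (transpose_mat ?Q *\<^sub>v col V i) $ j * y $ j)"
        using y by (simp only: scalar_prod_def atLeast0LessThan carrier_vecD)
      also have "\<dots> = (\<Sum>j<k. \<sigma> (Suc i) * (col U i \<bullet> b) * (y $ j * poly (\<pi> j) ((\<sigma> (Suc i))\<^sup>2)))"
        using entry \<pi> i by (intro sum.cong) (simp_all only: lessThan_iff mult_ac)
      also have "\<dots> = \<sigma> (Suc i) * (col U i \<bullet> b) * poly P ((\<sigma> (Suc i))\<^sup>2)"
        unfolding P_def poly_sum poly_smult sum_distrib_left ..
      finally show ?thesis .
    qed
    ultimately show ?thesis
      using k(1) by (intro exI[of _ P]) auto
  qed
  show "\<sigma> (Suc i) * (col U i \<bullet> b) \<noteq> 0" if "i < n" for i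
    using coeff[OF that] \<sigma>_pos[OF that] by simp
qed (use k \<sigma>_pos \<sigma>_decreasing \<theta>_decreasing in auto)

end

section \<open>Accuracy and interlacing of the Ritz values\<close>

lemma Delta_mat_eq:
  fixes \<sigma> :: "nat \<Rightarrow> real" and U :: "real mat" and b :: "real vec"
  assumes "k \<le> n"
  defines "c \<equiv> \<lambda>i. \<sigma> (Suc i) * (col U i \<bullet> b)"
  shows "Delta_mat n \<sigma> U b k =
    mat_diag (n - k) (\<lambda>i. c (k + i)) * mat (n - k) k (\<lambda>(i, j). \<sigma> (Suc (k + i)) ^ (2 * j))
      * minv (mat k k (\<lambda>(i, j). \<sigma> (Suc i) ^ (2 * j))) * minv (mat_diag k c)"
proof -
  have "mat k k (\<lambda>(i, j). D_mat n \<sigma> U b $$ (i, j)) = mat_diag k c"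
    "mat (n - k) (n - k) (\<lambda>(i, j). D_mat n \<sigma> U b $$ (k + i, k + j)) = mat_diag (n - k) (\<lambda>i. c (k + i))"
    "mat k k (\<lambda>(i, j). T_mat n \<sigma> k $$ (i, j)) = mat k k (\<lambda>(i, j). \<sigma> (Suc i) ^ (2 * j))"
    "mat (n - k) k (\<lambda>(i, j). T_mat n \<sigma> k $$ (k + i, j)) = mat (n - k) k (\<lambda>(i, j). \<sigma> (Suc (k + i)) ^ (2 * j))"
    using assms unfolding D_mat_def T_mat_def mat_diag_def coeff_col_def c_def
    by (intro eq_matI; auto)+
  then show ?thesis
    unfolding Delta_mat_def Let_def by simp
qed

context ritz_system
begin

text \<open>\<open>ritz_near\<close> with the term \<open>(s k)\<^sup>2\<close> absorbed into the normalization of \<open>\<eta>\<^sub>k\<close>.\<close>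

theorem ritz_near_eta:
  assumes s: "s = (\<lambda>i. \<sigma> (Suc i))" and c: "c = (\<lambda>i. \<sigma> (Suc i) * (col U i \<bullet> b))" and j: "j < k"
  shows "s j - t j \<le> sqrt (1 + (eta_k n \<sigma> U b k)\<^sup>2) * s k"
proof -
  define \<Delta> where "\<Delta> = Delta_mat n \<sigma> U b k"
  define S where "S = mat_diag k s * minv (1\<^sub>m k + transpose_mat \<Delta> * \<Delta>)"
  define h where "h = (mat_norm2 (S * (transpose_mat \<Delta> * \<Delta>)))\<^sup>2 + (mat_norm2 (S * transpose_mat \<Delta>))\<^sup>2"
  have \<Delta>: "\<Delta> \<in> carrier_mat (n - k) k" "tail = \<Delta> * head"
    using tail_eq_Delta_head k_less unfolding \<Delta>_def Delta_mat_eq[OF less_imp_le[OF k_less]] s c by simp_all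
  have sk: "0 < s k"
    using s_pos k_less by simp
  have eta: "eta_k n \<sigma> U b k = sqrt h / s k"
    unfolding eta_k_def Let_def h_def S_def \<Delta>_def s by simp
  have h: "0 \<le> h"
    unfolding h_def by simp
  have "s j - t j \<le> sqrt (h + (s k)\<^sup>2)"
    unfolding h_def S_def by (rule ritz_near[OF \<Delta> j])
  also have "h + (s k)\<^sup>2 = (1 + (eta_k n \<sigma> U b k)\<^sup>2) * (s k)\<^sup>2"
    unfolding eta using sk h by (simp add: power_divide field_simps)
  also have "sqrt \<dots> = sqrt (1 + (eta_k n \<sigma> U b k)\<^sup>2) * s k"
    using sk by (simp add: real_sqrt_mult)
  finally show ?thesis .
qed

end

text \<open>The ratio \<open>\<sigma>\<^sub>i / \<sigma>\<^bsub>i+1\<^esub> = ((i + 1) / i)\<^sup>\<alpha>\<close> decreases in \<open>i\<close>.\<close>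

lemma moderate_ratio_le:
  assumes mod: "moderately_ill_posed n \<sigma> \<zeta> \<alpha>" and i: "1 \<le> i" "i \<le> k" "k + 1 \<le> n"
  shows "(real (k + 1) / real k) powr \<alpha> * \<sigma> (i + 1) \<le> \<sigma> i"
proof -
  have \<zeta>: "0 < \<zeta>" and \<alpha>: "1 < \<alpha>"
    and \<sigma>: "\<sigma> i = \<zeta> * real i powr - \<alpha>" "\<sigma> (i + 1) = \<zeta> * real (i + 1) powr - \<alpha>"
    using mod i unfolding moderately_ill_posed_def by auto
  have "real (k + 1) / real k \<le> real (i + 1) / real i"
    using i by (simp add: field_simps)
  then have "(real (k + 1) / real k) powr \<alpha> \<le> (real (i + 1) / real i) powr \<alpha>"
    using \<alpha> i by (intro powr_mono2) auto
  then have "(real (k + 1) / real k) powr \<alpha> * \<sigma> (i + 1) \<le> (real (i + 1) / real i) powr \<alpha> * \<sigma> (i + 1)"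
    unfolding \<sigma> using \<zeta> by (intro mult_right_mono) auto
  also have "\<dots> = \<sigma> i"
  proof -
    have "0 < real i powr \<alpha>" "0 < real (i + 1) powr \<alpha>"
      using i by auto
    then show ?thesis
      unfolding \<sigma> using i by (simp add: powr_divide powr_minus field_simps del: of_nat_Suc)
  qed
  finally show ?thesis .
qed

lemma severe_geometric:
  assumes "severely_ill_posed n \<sigma> \<zeta> \<rho>" and "i < n"
  shows "\<sigma> (Suc i) = \<zeta> / \<rho> * (1 / \<rho>) ^ i"
proof -
  have \<rho>: "0 < \<rho>" and \<sigma>: "\<sigma> (Suc i) = \<zeta> * \<rho> powr (- real (Suc i))"
    using assms unfolding severely_ill_posed_def by auto
  have "\<rho> powr (- real (Suc i)) = 1 / (\<rho> * \<rho> ^ i)"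
    using \<rho> by (simp only: powr_minus powr_realpow power_Suc inverse_eq_divide)
  then show ?thesis
    unfolding \<sigma> using \<rho> by (simp add: power_one_over)
qed

text \<open>The threshold satisfies \<open>(1 + \<surd>2)\<^sup>2 = 3 + 2 \<surd>2 \<ge> 5\<close>.\<close>

lemma five_le_power2:
  assumes "1 + sqrt 2 \<le> (\<rho> :: real)"
  shows "5 \<le> \<rho>\<^sup>2"
proof -
  have "1 \<le> sqrt (2 :: real)"
    by simp
  then have "5 \<le> (1 + sqrt 2)\<^sup>2"
    unfolding power2_sum by simp
  also have "\<dots> \<le> \<rho>\<^sup>2"
    using assms by (intro power_mono) auto
  finally show ?thesis .
qed

theorem theorem8:
  fixes A U V :: "real mat" and b bhat e :: "real vec"
    and m n k0 :: nat
    and \<sigma> :: "nat \<Rightarrow> real"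
    and \<zeta> \<rho> \<alpha> \<beta> \<eta> :: real
    and p q :: "nat \<Rightarrow> real vec" and la lb :: "nat \<Rightarrow> real"
    and \<theta> :: "nat \<Rightarrow> nat \<Rightarrow> real"
  assumes A: "A \<in> carrier_mat m n" and b: "b \<in> carrier_vec m"
    and svd: "svd A U \<sigma> V"
    and simple: "\<forall>i\<in>{1..n}. \<forall>j\<in>{1..n}. i < j \<longrightarrow> \<sigma> j < \<sigma> i"
    and pos: "\<forall>i\<in>{1..n}. 0 < \<sigma> i"
    and ill_posed: "severely_ill_posed n \<sigma> \<zeta> \<rho> \<or> moderately_ill_posed n \<sigma> \<zeta> \<alpha>"
    and picard: "discrete_picard n \<sigma> U b bhat e \<beta> \<eta> k0"
    and nonzero: "\<forall>i\<in>{1..n}. coeff_col U i b \<noteq> 0"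
    and lanczos: "lanczos_bidiag A b n p q la lb"
    and completion: "\<forall>i\<in>{1..n}. 0 < la i \<and> 0 < lb (i + 1)"
    and ritz: "\<forall>k\<in>{1..k0}. singular_values (lanczos_B A p q k) (\<theta> k)"
    and label: "\<forall>k\<in>{1..k0}. \<forall>i\<in>{1..k}. \<forall>j\<in>{1..k}. i < j \<longrightarrow> \<theta> k j < \<theta> k i"
  shows "(\<forall>k\<in>{1..k0}. \<forall>i\<in>{1..k}.
            0 < \<sigma> i - \<theta> k i \<and> \<sigma> i - \<theta> k i \<le> sqrt (1 + (eta_k n \<sigma> U b k)\<^sup>2) * \<sigma> (k + 1))
       \<and> ((severely_ill_posed n \<sigma> \<zeta> \<rho> \<and> \<rho> \<ge> 1 + sqrt 2
           \<or> moderately_ill_posed n \<sigma> \<zeta> \<alpha> \<and>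
             (\<forall>k\<in>{1..k0}. 1 + sqrt (1 + (eta_k n \<sigma> U b k)\<^sup>2) < (real (k0 + 1) / real k0) powr \<alpha>))
          \<longrightarrow> (\<forall>k\<in>{1..k0}. \<forall>i\<in>{1..k}. \<sigma> (i + 1) < \<theta> k i \<and> \<theta> k i < \<sigma> i)
              \<and> (\<forall>k\<in>{1..k0}. \<not> (\<exists>i\<in>{1..k}. \<theta> k i < \<sigma> (k0 + 1))))"
proof -
  define c where "c = (\<lambda>i. \<sigma> (Suc i) * (col U i \<bullet> b))"
  have k0: "1 \<le> k0" "k0 + 1 \<le> n"
    using picard unfolding discrete_picard_def by auto
  have coeff: "col U i \<bullet> b \<noteq> 0" if "i < n" for i
    using nonzero that by (auto simp: coeff_col_def dest!: bspec[of _ _ "Suc i"])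
  have \<sigma>_pos: "0 < \<sigma> (Suc i)" if "i < n" for i
    using pos that by simp
  have \<sigma>_decreasing: "\<sigma> (Suc j) < \<sigma> (Suc i)" if "i < j" "j < n" for i j
    using simple that by simp
  have \<sigma>_mono: "\<sigma> (Suc j) \<le> \<sigma> (Suc i)" if "i \<le> j" "j < n" for i j
    using \<sigma>_decreasing[of i j] that by (cases "i = j") auto
  have "b \<noteq> 0\<^sub>v m"
    using coeff[of 0] k0 svd_dims(1,2)[OF A svd] by auto
  then interpret lanczos_run A b m n n p q la lb
    using A b lanczos completion vec_norm2_pos[OF b] by unfold_locales auto
  have system: "\<exists>W. ritz_system n k (\<lambda>i. \<sigma> (Suc i)) (\<lambda>j. \<theta> k (Suc j)) c W" if k: "k \<in> {1..k0}" for k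
  proof -
    obtain U' V' where svd_B: "svd (lanczos_B A p q k) U' (\<theta> k) V'"
      using bspec[OF ritz k] unfolding singular_values_def by auto
    have "ritz_system n k (\<lambda>i. \<sigma> (Suc i)) (\<lambda>j. \<theta> k (Suc j)) c (transpose_mat V * (Q_mat k * V'))"
      unfolding c_def by (rule ritz_system_lanczos[OF svd svd_B])
        (use k k0 label coeff \<sigma>_pos \<sigma>_decreasing in auto)
    then show ?thesis
      by blast
  qed
  have bounds: "\<theta> k i < \<sigma> i" "\<sigma> i - \<theta> k i \<le> sqrt (1 + (eta_k n \<sigma> U b k)\<^sup>2) * \<sigma> (k + 1)"
    if k: "k \<in> {1..k0}" and i: "i \<in> {1..k}" for k i
  proof -
    obtain W where "ritz_system n k (\<lambda>i. \<sigma> (Suc i)) (\<lambda>j. \<theta> k (Suc j)) c W"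
      using system[OF k] by auto
    then interpret ritz_system n k "\<lambda>i. \<sigma> (Suc i)" "\<lambda>j. \<theta> k (Suc j)" c W .
    show "\<theta> k i < \<sigma> i" "\<sigma> i - \<theta> k i \<le> sqrt (1 + (eta_k n \<sigma> U b k)\<^sup>2) * \<sigma> (k + 1)"
      using ritz_less[of "i - 1"] ritz_near_eta[of \<sigma> U b "i - 1"] i by (auto simp: c_def)
  qed
  have severe: "\<sigma> (i + 1) < \<theta> k i"
    if sev: "severely_ill_posed n \<sigma> \<zeta> \<rho>" "1 + sqrt 2 \<le> \<rho>" and k: "k \<in> {1..k0}" and i: "i \<in> {1..k}" for k i
  proof -
    obtain W where "ritz_system n k (\<lambda>i. \<sigma> (Suc i)) (\<lambda>j. \<theta> k (Suc j)) c W"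
      using system[OF k] by auto
    then interpret ritz_system n k "\<lambda>i. \<sigma> (Suc i)" "\<lambda>j. \<theta> k (Suc j)" c W .
    have \<zeta>: "0 < \<zeta>" and \<rho>: "1 < \<rho>"
      using sev(1) unfolding severely_ill_posed_def by auto
    have geometric: "\<sigma> (Suc i) = \<zeta> / \<rho> * (1 / \<rho>) ^ i" if "i < n" for i
      using severe_geometric[OF sev(1) that] .
    have coeff_mono: "\<bar>col U i \<bullet> b\<bar> \<le> \<bar>col U j \<bullet> b\<bar>" if "j \<le> i" "i < n" for i j
      using that
    proof (induction i rule: dec_induct)
      case (step i)
      have "\<bar>coeff_col U (Suc i + 1) b\<bar> \<le> \<bar>coeff_col U (Suc i) b\<bar>"
        using picard step unfolding discrete_picard_def by auto
      then show ?case
        using step unfolding coeff_col_def by simp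
    qed simp
    have "\<bar>c i\<bar> \<le> (1 / \<rho>) ^ (i - j) * \<bar>c j\<bar>" if ij: "j \<le> i" "i < n" for i j
    proof -
      have "(1 / \<rho>) ^ i = (1 / \<rho>) ^ (i - j) * (1 / \<rho>) ^ j"
        using ij by (simp add: power_add[symmetric])
      then have "\<sigma> (Suc i) = (1 / \<rho>) ^ (i - j) * \<sigma> (Suc j)"
        using geometric[of i] geometric[of j] ij by simp
      then show ?thesis
        using coeff_mono[OF ij] \<rho> \<sigma>_pos[of j] ij unfolding c_def abs_mult
        by (simp add: mult_left_mono abs_mult)
    qed
    moreover have "(1 / \<rho>)\<^sup>2 \<le> 1/5"
      using five_le_power2[OF sev(2)] \<rho> by (simp add: power_one_over pos_divide_le_eq)
    ultimately have "\<sigma> (Suc (Suc (i - 1))) < \<theta> k (Suc (i - 1))"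
      using \<zeta> \<rho> geometric i by (intro geometric_ritz_greater[of "\<zeta> / \<rho>" "1 / \<rho>"]) auto
    then show ?thesis
      using i by simp
  qed
  have moderate: "\<sigma> (i + 1) < \<theta> k i"
    if mod: "moderately_ill_posed n \<sigma> \<zeta> \<alpha>"
      "1 + sqrt (1 + (eta_k n \<sigma> U b k)\<^sup>2) < (real (k0 + 1) / real k0) powr \<alpha>"
      and k: "k \<in> {1..k0}" and i: "i \<in> {1..k}" for k i
  proof -
    let ?s = "sqrt (1 + (eta_k n \<sigma> U b k)\<^sup>2)"
    have \<sigma>: "0 < \<sigma> (i + 1)" "\<sigma> (k + 1) \<le> \<sigma> (i + 1)"
      using \<sigma>_pos[of i] \<sigma>_mono[of i k] k i k0 by auto
    have "(1 + ?s) * \<sigma> (i + 1) < (real (k0 + 1) / real k0) powr \<alpha> * \<sigma> (i + 1)"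
      using mod(2) \<sigma>(1) by (rule mult_strict_right_mono)
    also have "\<dots> \<le> \<sigma> i"
      using k i k0 by (intro moderate_ratio_le[OF mod(1)]) auto
    finally have "\<sigma> (i + 1) + ?s * \<sigma> (i + 1) < \<sigma> i"
      by (simp add: distrib_right)
    moreover have "?s * \<sigma> (k + 1) \<le> ?s * \<sigma> (i + 1)"
      using \<sigma>(2) by (intro mult_left_mono) auto
    ultimately show ?thesis
      using bounds(2)[OF k i] by linarith
  qed
  show ?thesis
  proof (intro conjI impI ballI)
    assume "severely_ill_posed n \<sigma> \<zeta> \<rho> \<and> \<rho> \<ge> 1 + sqrt 2
        \<or> moderately_ill_posed n \<sigma> \<zeta> \<alpha> \<and>
          (\<forall>k\<in>{1..k0}. 1 + sqrt (1 + (eta_k n \<sigma> U b k)\<^sup>2) < (real (k0 + 1) / real k0) powr \<alpha>)"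
    then have lower: "\<sigma> (i + 1) < \<theta> k i" if "k \<in> {1..k0}" "i \<in> {1..k}" for k i
      using severe[of k i] moderate[of k i] that by auto
    show "\<sigma> (i + 1) < \<theta> k i" "\<theta> k i < \<sigma> i" if "k \<in> {1..k0}" "i \<in> {1..k}" for k i
      using lower[OF that] bounds(1)[OF that] .
    show "\<not> (\<exists>i\<in>{1..k}. \<theta> k i < \<sigma> (k0 + 1))" if k: "k \<in> {1..k0}" for k
    proof
      assume "\<exists>i\<in>{1..k}. \<theta> k i < \<sigma> (k0 + 1)"
      then obtain i where i: "i \<in> {1..k}" "\<theta> k i < \<sigma> (k0 + 1)"
        by auto
      have "\<sigma> (k0 + 1) \<le> \<sigma> (i + 1)"
        using \<sigma>_mono[of i k0] k i(1) k0 by simp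
      then show False
        using lower[OF k i(1)] i(2) by simp
    qed
  qed (use bounds in auto)
qed

end
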